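(* Let $k\ge0$ be an integer, regard $n$ as an indeterminate (with a formal square root $\sqrt n$), and let $G_{kn}$ be the Gram matrix associated to $H_n^+$. Then, as an identity of rational functions in $\sqrt n$, $$\det(G_{kn})=(\sqrt n)^{a_k}\prod_{r=1}^{[k/2]}P_r(\sqrt n)^{2d'_{k/2,r}},$$ with $d'_{sr}=f'_{sr}-f'_{s,r+1}$, where $f'_{sr}=\binom{3s}{s-r}-\binom{3s}{s-r-1}$ for $s\in\mathbb Z$, and $f'_{sr}=0$ for $s\notin\mathbb Z$.
   Context: Let $\mathcal P_h^+(k)$ be the set of noncrossing set partitions of $\{1,\dots,k\}$ with all blocks of even size. The Gram matrix associated to $H_n^+$ is $G_{kn}=(n^{|\pi\vee\sigma|})_{\pi,\sigma\in\mathcal P_h^+(k)}$, where $\pi\vee\sigma$ is the join in the lattice of all set partitions of $\{1,\dots,k\}$ and $|\cdot|$ is the number of blocks; the determinant of an empty matrix is $1$. Put $a_k=\sum_{\pi\in\mathcal P_h^+(k)}(2|\pi|-k)$. The Chebyshev polynomials $P_r$ are given by $P_0=1$, $P_1=n$, $P_{r+1}=nP_r-P_{r-1}$ (and $P_r(\sqrt n)$ is $P_r$ evaluated at $\sqrt n$). $[x]$ denotes the integer part, and binomial coefficients with negative lower index are $0$. *)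

theory Defs
  imports
    Jordan_Normal_Form.Determinant
    "HOL-Library.Disjoint_Sets"
    "HOL-Computational_Algebra.Polynomial_Factorial"
begin

definition noncrossing :: "nat set set \<Rightarrow> bool" where
  "noncrossing P \<longleftrightarrow>
     \<not> (\<exists>B\<in>P. \<exists>C\<in>P. B \<noteq> C \<and>
          (\<exists>i\<in>B. \<exists>j\<in>C. \<exists>k\<in>B. \<exists>l\<in>C. i < j \<and> j < k \<and> k < l))"

definition nc_even_partitions :: "nat \<Rightarrow> nat set set set" where
  "nc_even_partitions k =
     {P. partition_on {1..k} P \<and> noncrossing P \<and> (\<forall>B\<in>P. even (card B))}"

lemma finite_nc_even_partitions: "finite (nc_even_partitions k)"
  by (rule finite_subset[OF _ finitely_many_partition_on[of "{1..k}"]])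
     (auto simp: nc_even_partitions_def)

definition is_partition_lub ::
    "'a set \<Rightarrow> 'a set set \<Rightarrow> 'a set set \<Rightarrow> 'a set set \<Rightarrow> bool" where
  "is_partition_lub A P Q R \<longleftrightarrow>
     refines A P R \<and> refines A Q R \<and>
     (\<forall>S. refines A P S \<and> refines A Q S \<longrightarrow> refines A R S)"

text \<open>The join in the lattice of all partitions of \<open>A\<close>, ordered by refinement; it need not be
  noncrossing, even if \<open>P\<close> and \<open>Q\<close> are. The description is well defined by
  \<open>partition_join\<close> below.\<close>

definition partition_join :: "'a set \<Rightarrow> 'a set set \<Rightarrow> 'a set set \<Rightarrow> 'a set set" where
  "partition_join A P Q = (THE R. is_partition_lub A P Q R)"

lemma is_partition_lub_unique:
  "is_partition_lub A P Q R \<Longrightarrow> is_partition_lub A P Q R' \<Longrightarrow> R = R'"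
  unfolding is_partition_lub_def by (meson refines_asym)

lemma is_partition_lub_exists:
  assumes P: "partition_on A P" and Q: "partition_on A Q"
  shows "\<exists>R. is_partition_lub A P Q R"
proof -
  define U where "U = {S. refines A P S \<and> refines A Q S}"
  have top: "refines A X (if A = {} then {} else {A})" if "partition_on A X" for X
    using that partition_on_space[of A]
    by (auto simp: refines_def partition_on_empty dest: partition_onD1)
  have ne: "U \<noteq> {}"
    using top[OF P] top[OF Q] unfolding U_def by blast
  have U: "partition_on A S" if "S \<in> U" for S
    using that by (simp add: U_def refines_def)
  have "refines A P (common_refinement U)" "refines A Q (common_refinement U)"
    by (rule common_refinement_coarsest; use U ne P Q in \<open>simp add: U_def\<close>)+
  moreover have "refines A (common_refinement U) S" if "S \<in> U" for S
    using U that by (rule refines_common_refinement)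
  ultimately show ?thesis
    unfolding is_partition_lub_def U_def by blast
qed

lemma partition_join:
  assumes "partition_on A P" and "partition_on A Q"
  shows "is_partition_lub A P Q (partition_join A P Q)"
  unfolding partition_join_def
  using is_partition_lub_exists[OF assms] is_partition_lub_unique
  by (metis theI)

text \<open>The rows and columns are indexed by the positions in a list \<open>ps\<close> that enumerates
  the partitions.\<close>

definition gram_matrix :: "nat \<Rightarrow> 'a::comm_ring_1 \<Rightarrow> nat set set list \<Rightarrow> 'a mat" where
  "gram_matrix k n ps =
     mat (length ps) (length ps)
       (\<lambda>(i, j). n ^ card (partition_join {1..k} (ps ! i) (ps ! j)))"

definition a_exp :: "nat \<Rightarrow> int" where
  "a_exp k = (\<Sum>P\<in>nc_even_partitions k. 2 * int (card P) - int k)"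

fun cheb_poly :: "nat \<Rightarrow> 'a::comm_ring_1 poly" where
  "cheb_poly 0 = 1"
| "cheb_poly (Suc 0) = [:0, 1:]"
| "cheb_poly (Suc (Suc r)) = [:0, 1:] * cheb_poly (Suc r) - cheb_poly r"

definition binomial_int :: "nat \<Rightarrow> int \<Rightarrow> nat" where
  "binomial_int m j = (if j < 0 then 0 else m choose nat j)"

text \<open>Only \<open>s \<ge> 0\<close> is used (\<open>s = k / 2\<close>), so the conversion of the upper index
  to a natural number loses nothing.\<close>

definition f_coeff :: "rat \<Rightarrow> int \<Rightarrow> int" where
  "f_coeff s r =
     (if s \<in> \<int>
      then int (binomial_int (nat \<lfloor>3 * s\<rfloor>) (\<lfloor>s\<rfloor> - r)) -
           int (binomial_int (nat \<lfloor>3 * s\<rfloor>) (\<lfloor>s\<rfloor> - r - 1))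
      else 0)"

definition d_coeff :: "rat \<Rightarrow> int \<Rightarrow> int" where
  "d_coeff s r = f_coeff s r - f_coeff s (r + 1)"

text \<open>The rational functions in \<open>\<surd>n\<close> are the fraction field of the polynomials in the
  indeterminate \<open>\<surd>n\<close>; the indeterminate \<open>n\<close> is its square.\<close>

definition sqrt_n :: "rat poly fract" where
  "sqrt_n = to_fract [:0, 1:]"

end

theory Submission
  imports Defs "HOL-Computational_Algebra.Formal_Power_Series"
begin

text \<open>
  Write \<open>t\<close> for the square root of \<open>n\<close>. Doubling every point turns a noncrossing partition of
  \<open>k\<close> points into a noncrossing pairing of \<open>2 k\<close> strand ends, and the blocks are all even if
  and only if every pair joins ends of equal colour, where the ends are coloured periodically
  \<open>a b b a a b b a\<close> and so on. If the pairings of \<open>P\<close> and \<open>Q\<close> are glued along their common ends, they form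
  some number \<open>l\<close> of loops, and \<open>l = k + 2 \<bar>P \<or> Q\<bar> - \<bar>P\<bar> - \<bar>Q\<bar>\<close>. So up to powers of \<open>t\<close>
  attached to rows and columns, which make up the factor \<open>t\<close> to the power \<open>a\<^sub>k\<close>, the Gram matrix is the
  matrix of the \<open>t ^ l\<close>.

  These powers are evaluated by state sums. Take a graph with coloured edges and an eigenvector \<open>d\<close>,
  for the eigenvalue \<open>t\<close>, of the adjacency matrix of every colour. Label the regions of the glued
  picture by vertices so that regions separated by a strand are adjacent, with the unbounded region at a base
  vertex, and weight each labelling by suitable powers of the values of \<open>d\<close>. The eigenvector equation sums
  out the region inside an innermost loop and produces a factor \<open>t\<close>; a strand that bends back and forth can be
  pulled straight. Hence the state sum is \<open>t ^ l\<close>, whatever the graph (\<open>pairing_loop_count\<close>). Two graphs are used.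

  For a star with four leaves, \<open>t = 2\<close>, a labelling is a function on the \<open>k\<close> points that is constant
  on the blocks of both partitions, so the state sum counts functions that are constant on the
  blocks of the join. This gives the formula for \<open>l\<close> without any planar topology
  (\<open>loop_count_partition_join\<close>).

  For the infinite tree whose vertices are the stacks of colours, the closed walks at the root are again the
  pairings, and the state sum factors the matrix as \<open>V D V\<^sup>T\<close> with \<open>D\<close> diagonal and rows and columns
  indexed alike. A walk that contributes to a pairing is
  nowhere higher than the pairing is deep, so \<open>V\<close> is triangular. The entries of \<open>d\<close> are products of
  Chebyshev values, one for each run of equal colours in the stack, and the determinant becomes the product,
  over all pairings and all of their arcs, of \<open>P\<^sub>r / P\<^bsub>r - 1\<^esub>\<close>, where \<open>r\<close> is the number of arcs in the
  innermost run of equally coloured nested arcs that ends with the given one (\<open>det_gram_matrix_rise_weight\<close>).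

  It remains to count the arcs with a given \<open>r\<close>. Reading the words letter by letter gives a linear recursion for
  their generating functions, which has a closed solution in terms of the power series \<open>B = 1 + z\<^sup>4 B\<^sup>3\<close>; the
  coefficients of this solution are twice the ballot numbers in the theorem (\<open>total_rises_even_word\<close>).
\<close>

section \<open>Coloured noncrossing pairings as words\<close>

text \<open>
  A noncrossing pairing of the letters of a colour word is coded by a word of booleans, \<open>True\<close> where an
  arc opens and \<open>False\<close> where one closes. Because of planarity a closing letter always
  belongs to the arc opened last, so a stack of the colours of the open arcs suffices to check
  that every arc joins letters of equal colour.
\<close>

fun admissible :: "'k list \<Rightarrow> 'k list \<Rightarrow> bool list \<Rightarrow> bool" where
  "admissible q [] [] = (q = [])"
| "admissible q [] (_ # _) = False"
| "admissible q (_ # _) [] = False"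
| "admissible q (k # w) (True # c) = admissible (k # q) w c"
| "admissible q (k # w) (False # c) = (q \<noteq> [] \<and> hd q = k \<and> admissible (tl q) w c)"

lemma admissible_length: "admissible q w c \<Longrightarrow> length c = length w"
  by (induction q w c rule: admissible.induct) auto

fun balanced :: "nat \<Rightarrow> bool list \<Rightarrow> bool" where
  "balanced n [] = (n = 0)"
| "balanced n (True # c) = balanced (Suc n) c"
| "balanced n (False # c) = (n > 0 \<and> balanced (n - 1) c)"

text \<open>
  The letter that closes the upper of two adjacent open arcs of colour \<open>k\<close> may as well open an arc in place of the lower one:
  before that letter nothing looks below these arcs, and after it both readings
  have the same stack. This is the effect on a pairing of connecting two adjacent letters at which it opens arcs.
\<close>

lemma admissible_split_matching:
  assumes "admissible (Q @ k # k # q) w c"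
  shows "\<exists>z1 z2 w1 w2. c = z1 @ False # z2 \<and> w = w1 @ k # w2 \<and> length z1 = length w1 \<and>
           balanced (length Q) z1 \<and> admissible (Q @ q) w (z1 @ True # z2)"
  using assms
proof (induction c arbitrary: Q w)
  case Nil
  then show ?case by (cases w) auto
next
  case (Cons e c)
  then obtain l w' where w: "w = l # w'" by (cases w) auto
  show ?case
  proof (cases e)
    case True
    then have "admissible ((l # Q) @ k # k # q) w' c" using Cons.prems w by simp
    from Cons.IH[OF this] obtain z1 z2 w1 w2 where
      "c = z1 @ False # z2" "w' = w1 @ k # w2" "length z1 = length w1"
      "balanced (length (l # Q)) z1" "admissible ((l # Q) @ q) w' (z1 @ True # z2)" by blast
    then show ?thesis using True w
      by (intro exI[of _ "True # z1"] exI[of _ z2] exI[of _ "l # w1"] exI[of _ w2]) auto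
  next
    case False
    show ?thesis
    proof (cases Q)
      case Nil
      then show ?thesis using False Cons.prems w
        by (intro exI[of _ "[]"] exI[of _ c] exI[of _ "[]"] exI[of _ w']) auto
    next
      case (Cons a Q')
      then have "admissible (Q' @ k # k # q) w' c" and a: "a = l"
        using Cons.prems w False by auto
      from Cons.IH[OF this(1)] obtain z1 z2 w1 w2 where
        "c = z1 @ False # z2" "w' = w1 @ k # w2" "length z1 = length w1"
        "balanced (length Q') z1" "admissible (Q' @ q) w' (z1 @ True # z2)" by blast
      then show ?thesis using False w Cons a
        by (intro exI[of _ "False # z1"] exI[of _ z2] exI[of _ "l # w1"] exI[of _ w2]) auto
    qed
  qed
qed

text \<open>
  The number of loops formed by two pairings of the same letters, obtained by removing arcs of the second
  pairing that join adjacent letters. Such an arc either closes a loop with an arc of the first pairing or connects two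
  arcs of the first pairing that both open there. It is enough to remove an arc where the first closing letter
  of either word occurs, hence the prefix \<open>u\<close> on which both words open. Unlike the state sums below, this relation mentions
  no graph and no field, so it can carry information from one graph to another.
\<close>

inductive loop_count :: "'k list \<Rightarrow> bool list \<Rightarrow> bool list \<Rightarrow> nat \<Rightarrow> bool" where
  empty: "loop_count [] [] [] 0"
| close: "loop_count (u @ k # k # w) (replicate (length u) True @ True # False # c)
            (replicate (length u) True @ True # False # d) (Suc l)"
  if "loop_count (u @ w) (replicate (length u) True @ c) (replicate (length u) True @ d) l"
| straighten: "loop_count (u @ k # k # w1 @ k # w2)
      (replicate (length u) True @ True # True # z1 @ False # z2)
      (replicate (length u) True @ True # False # d) l"
  if "loop_count (u @ w1 @ k # w2) (replicate (length u) True @ z1 @ True # z2)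
        (replicate (length u) True @ d) l"
    and "length z1 = length w1" and "balanced 0 z1"
| sym: "loop_count w d c l" if "loop_count w c d l"

lemma admissible_append_opens:
  "admissible q w (replicate n True @ c) \<longleftrightarrow>
     (\<exists>u w'. w = u @ w' \<and> length u = n \<and> admissible (rev u @ q) w' c)"
proof (induction n arbitrary: q w)
  case 0
  then show ?case by simp
next
  case (Suc n)
  show ?case
  proof (cases w)
    case Nil
    then show ?thesis by simp
  next
    case (Cons k w')
    have "admissible q w (replicate (Suc n) True @ c) \<longleftrightarrow>
        admissible (k # q) w' (replicate n True @ c)" using Cons by simp
    also have "\<dots> \<longleftrightarrow> (\<exists>u v. w' = u @ v \<and> length u = n \<and> admissible (rev u @ k # q) v c)"
      by (rule Suc.IH)
    also have "\<dots> \<longleftrightarrow> (\<exists>u v. w = u @ v \<and> length u = Suc n \<and> admissible (rev u @ q) v c)"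
      unfolding Cons
      apply (rule iffI)
       apply (elim exE conjE)
      subgoal for u v by (rule exI[of _ "k # u"]) auto
      apply (elim exE conjE)
      subgoal for u v by (cases u) auto
      done
    finally show ?thesis .
  qed
qed

lemma admissible_first_close:
  assumes "admissible [] w c" "c \<noteq> []"
  obtains n c' where "c = replicate n True @ True # False # c'"
proof -
  define n where "n = length (takeWhile id c)"
  have c: "c = replicate n True @ dropWhile id c"
    by (metis (full_types) eq_id_iff n_def replicate_eqI set_takeWhileD takeWhile_dropWhile_id)
  have "dropWhile id c \<noteq> []"
  proof
    assume "dropWhile id c = []"
    then have "c = replicate n True @ []" using c by metis
    then have "admissible [] w (replicate n True @ [])" using assms by simp
    then obtain u w' where "w = u @ w'" "length u = n" "admissible (rev u @ []) w' []"
      unfolding admissible_append_opens by metis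
    then have "n = 0" by (cases w') auto
    then show False using \<open>c = replicate n True @ []\<close> assms by simp
  qed
  then obtain c' where d: "dropWhile id c = False # c'"
    by (cases "dropWhile id c") (use hd_dropWhile[of id c] in auto)
  have "n \<noteq> 0"
  proof
    assume "n = 0"
    then have "c = False # c'" using c d by simp
    then show False using assms(1) by (cases w) auto
  qed
  then obtain m where "n = Suc m" by (cases n) auto
  then have "c = replicate m True @ True # False # c'" using c d by (simp add: replicate_app_Cons_same)
  then show ?thesis using that by blast
qed

text \<open>
  The word with the earlier first closing letter has an arc joining adjacent letters there. The other word opens at the
  first of these two letters, and closes or opens at the second; these are the cases \<open>close\<close> and \<open>straighten\<close>.
\<close>

lemma loop_count_exists:
  assumes "admissible [] w c" "admissible [] w d"
  shows "\<exists>l. loop_count w c d l"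
  using assms
proof (induction "length w" arbitrary: w c d rule: less_induct)
  case less
  show ?case
  proof (cases "w = []")
    case True
    then have "c = []" "d = []" using less.prems by (auto dest!: admissible_length)
    then show ?thesis using True loop_count.empty by auto
  next
    case False
    then have "c \<noteq> []" "d \<noteq> []" using less.prems by (auto dest!: admissible_length)
    then obtain n c' m d' where c: "c = replicate n True @ True # False # c'"
      and d: "d = replicate m True @ True # False # d'"
      using less.prems by (metis admissible_first_close)
    \<comment> \<open>by symmetry it suffices to treat the case in which the second word closes first\<close>
    have *: "\<exists>l. loop_count w x y l"
      if x: "x = replicate n True @ True # False # x'" and y: "y = replicate m True @ True # False # y'"
        and "m \<le> n" and ax: "admissible [] w x" and ay: "admissible [] w y" for n m x y x' y'
    proof -
      from ay y obtain u w0 where w: "w = u @ w0" and u: "length u = m"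
        and y0: "admissible (rev u) w0 (True # False # y')"
        by (auto simp: admissible_append_opens)
      then obtain k w1 where w0: "w0 = k # k # w1" and y1: "admissible (rev u) w1 y'"
        by (cases w0; cases "tl w0") auto
      have "x = replicate m True @ replicate (n - m) True @ True # False # x'"
        using x \<open>m \<le> n\<close> by (simp flip: replicate_add append_assoc)
      then obtain v v' where v: "w = v @ v'" "length v = m"
        "admissible (rev v @ []) v' (replicate (n - m) True @ True # False # x')"
        using ax by (metis admissible_append_opens)
      then have "v = u" "v' = w0" using w u by auto
      then have x0: "admissible (rev u) w0 (replicate (n - m) True @ True # False # x')"
        using v by simp
      have ay': "admissible [] (u @ v) (replicate m True @ z)" if "admissible (rev u) v z" for v z
        using that u by (auto simp: admissible_append_opens)
      show ?thesis
      proof (cases "n - m")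
        case 0
        then have "n = m" using \<open>m \<le> n\<close> by simp
        from 0 x0 w0 have x1: "admissible (rev u) w1 x'" by simp
        have "\<exists>l. loop_count (u @ w1) (replicate m True @ x') (replicate m True @ y') l"
          by (rule less.hyps) (use w w0 ay' x1 y1 in auto)
        then show ?thesis using loop_count.close u x y w w0 \<open>n = m\<close> by metis
      next
        case (Suc i)
        define r where "r = replicate i True @ False # x'"
        have xr: "x = replicate m True @ True # True # r"
          using x \<open>m \<le> n\<close> Suc unfolding r_def
          by (smt (verit, ccfv_threshold) append.assoc append_Cons append_Nil le_add_diff_inverse replicate_Suc replicate_add replicate_app_Cons_same)
        have "admissible (rev u) w0 (True # True # r)"
          using x0 Suc unfolding r_def by (simp add: replicate_app_Cons_same)
        then have "admissible ([] @ k # k # rev u) w1 r" using w0 by simp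
        from admissible_split_matching[OF this] obtain z1 z2 v1 v2 where
          r: "r = z1 @ False # z2" "w1 = v1 @ k # v2" "length z1 = length v1"
          "balanced 0 z1" "admissible (rev u) w1 (z1 @ True # z2)" by auto
        have "\<exists>l. loop_count (u @ w1) (replicate m True @ z1 @ True # z2) (replicate m True @ y') l"
          by (rule less.hyps) (use w w0 ay' y1 r in auto)
        then show ?thesis using loop_count.straighten[of u v1 k v2 z1 z2 y'] r u xr y w w0 by auto
      qed
    qed
    show ?thesis
    proof (cases "m \<le> n")
      case True
      then show ?thesis using * c d less.prems by blast
    next
      case False
      then have "n \<le> m" by simp
      then show ?thesis using *[OF d c] less.prems loop_count.sym by blast
    qed
  qed
qed

text \<open>
  When an arc of colour \<open>k\<close> is opened inside the arcs with colours \<open>q\<close>, the innermost run of equally coloured arcs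
  has length \<open>run_length k (k # q)\<close>.
\<close>

definition run_length :: "'k \<Rightarrow> 'k list \<Rightarrow> nat" where
  "run_length k q = length (takeWhile ((=) k) q)"

lemma run_length_simps [simp]:
  "run_length k [] = 0"
  "run_length k (l # q) = (if k = l then Suc (run_length k q) else 0)"
  by (simp_all add: run_length_def)

fun rises :: "nat \<Rightarrow> 'k list \<Rightarrow> 'k list \<Rightarrow> bool list \<Rightarrow> nat" where
  "rises r q (k # w) (True # c) = of_bool (run_length k (k # q) = r) + rises r (k # q) w c"
| "rises r q (k # w) (False # c) = rises r (tl q) w c"
| "rises r q [] c = 0"
| "rises r q w [] = 0"

definition admissible_words :: "'k list \<Rightarrow> 'k list \<Rightarrow> bool list set" where
  "admissible_words q w = {c. admissible q w c}"

lemma admissible_words_Nil: "admissible_words q [] = (if q = [] then {[]} else {})"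
proof -
  have "admissible q [] c \<longleftrightarrow> q = [] \<and> c = []" for c by (cases c) auto
  then show ?thesis by (auto simp: admissible_words_def)
qed

lemma admissible_words_Cons:
  "admissible_words q (k # w) = (#) True ` admissible_words (k # q) w \<union>
     (if q \<noteq> [] \<and> hd q = k then (#) False ` admissible_words (tl q) w else {})"
proof -
  have "admissible q (k # w) c \<longleftrightarrow> (\<exists>c'. c = True # c' \<and> admissible (k # q) w c') \<or>
    (q \<noteq> [] \<and> hd q = k \<and> (\<exists>c'. c = False # c' \<and> admissible (tl q) w c'))" for c
    by (cases c; cases "hd c") auto
  then show ?thesis by (auto simp: admissible_words_def)
qed

lemma finite_admissible_words [simp]: "finite (admissible_words q w)"
  by (induction w arbitrary: q) (auto simp: admissible_words_Nil admissible_words_Cons)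

lemma sum_admissible_words_Cons:
  "sum f (admissible_words q (k # w)) = (\<Sum>c\<in>admissible_words (k # q) w. f (True # c)) +
     (if q \<noteq> [] \<and> hd q = k then \<Sum>c\<in>admissible_words (tl q) w. f (False # c) else (0::'a::comm_monoid_add))"
proof -
  have "sum f (admissible_words q (k # w)) = sum f ((#) True ` admissible_words (k # q) w) +
     sum f (if q \<noteq> [] \<and> hd q = k then (#) False ` admissible_words (tl q) w else {})"
    unfolding admissible_words_Cons by (rule sum.union_disjoint) auto
  then show ?thesis by (simp add: sum.reindex inj_on_def o_def)
qed

definition total_rises :: "nat \<Rightarrow> 'k list \<Rightarrow> 'k list \<Rightarrow> nat" where
  "total_rises r q w = (\<Sum>c\<in>admissible_words q w. rises r q w c)"

lemma card_admissible_words_Cons: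
  "card (admissible_words q (k # w)) = card (admissible_words (k # q) w) +
     (if q \<noteq> [] \<and> hd q = k then card (admissible_words (tl q) w) else 0)"
  by (simp only: card_eq_sum sum_admissible_words_Cons)

lemma total_rises_Cons:
  "total_rises r q (k # w) = total_rises r (k # q) w +
     of_bool (run_length k (k # q) = r) * card (admissible_words (k # q) w) +
     (if q \<noteq> [] \<and> hd q = k then total_rises r (tl q) w else 0)"
  by (simp add: total_rises_def sum_admissible_words_Cons sum.distrib)

lemma total_rises_Nil: "total_rises r q [] = 0"
  by (simp add: total_rises_def)

section \<open>State sums on graphs with an eigenvector\<close>

text \<open>
  The sum over the walks from \<open>q\<close> to \<open>b\<close> whose steps have the colours \<open>w\<close>; a walk is given to \<open>f\<close> as the list of
  its vertices after the first.
\<close>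

fun path_sum :: "('k \<Rightarrow> 'v \<Rightarrow> 'v set) \<Rightarrow> 'v \<Rightarrow> 'k list \<Rightarrow> 'v \<Rightarrow> ('v list \<Rightarrow> 'f::comm_monoid_add) \<Rightarrow> 'f"
  where
  "path_sum nb b [] q f = (if q = b then f [] else 0)"
| "path_sum nb b (k # w) q f = (\<Sum>x\<in>nb k q. path_sum nb b w x (\<lambda>h. f (x # h)))"

text \<open>
  The amplitude of a walk in a pairing. The arcs that are open at a letter bound nested regions, and \<open>S\<close> lists their
  labels, innermost first. An opening letter enters a fresh region, which takes the vertex of the walk as its label at
  the price of a factor \<open>d\<close>; a closing letter returns to the next outer region, so the walk has to return
  to the label of that region.
\<close>

fun run :: "('v \<Rightarrow> 'f::field) \<Rightarrow> 'v list \<Rightarrow> bool list \<Rightarrow> 'v list \<Rightarrow> 'f" where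
  "run d S (True # c) (x # h) = d x * run d (x # S) c h"
| "run d S (False # c) (x # h) = (if tl S \<noteq> [] \<and> hd (tl S) = x then run d (tl S) c h else 0)"
| "run d S [] h = 1"
| "run d S (e # c) [] = 1"

definition path_weight :: "('v \<Rightarrow> 'f::field) \<Rightarrow> 'v list \<Rightarrow> 'f" where
  "path_weight d h = (\<Prod>x\<leftarrow>h. 1 / d x)"

lemma path_weight_simps [simp]:
  "path_weight d [] = 1" "path_weight d (x # h) = path_weight d h / d x"
  by (simp_all add: path_weight_def)

locale loop_model =
  fixes nb :: "'k \<Rightarrow> 'v \<Rightarrow> 'v set" and d :: "'v \<Rightarrow> 'f::field" and t :: 'f and b :: 'v
  assumes finite_nb [simp]: "finite (nb k x)"
    and nb_sym: "y \<in> nb k x \<Longrightarrow> x \<in> nb k y"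
    and d_nonzero [simp]: "d x \<noteq> 0"
    and harmonic: "(\<Sum>y\<in>nb k x. d y) = t * d x"
begin

definition pairing :: "'k list \<Rightarrow> 'v list \<Rightarrow> 'v list \<Rightarrow> bool list \<Rightarrow> bool list \<Rightarrow> 'f" where
  "pairing w S S' c c' =
     path_sum nb b w (hd S) (\<lambda>h. path_weight d h * run d S c h * run d S' c' h)"

lemma path_sum_scale: "path_sum nb b w q (\<lambda>h. a * f h) = (a::'f) * path_sum nb b w q f"
  by (induction w arbitrary: q f) (auto simp: sum_distrib_left)

lemma path_sum_zero: "path_sum nb b w q (\<lambda>h. 0) = (0::'f)"
  by (induction w arbitrary: q) auto

lemma path_sum_cong:
  "(\<And>h. f h = g h) \<Longrightarrow> path_sum nb b w q f = (path_sum nb b w q g :: 'f)"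
  by presburger

lemma pairing_commute: "pairing w S S' c c' = pairing w S' S c' c" if "hd S = hd S'"
  unfolding pairing_def that by (simp add: mult_ac)

lemma pairing_open_open:
  "pairing (k # w) S S (True # c) (True # c') = (\<Sum>x\<in>nb k (hd S). d x * pairing w (x # S) (x # S) c c')"
proof -
  have "path_sum nb b w x (\<lambda>h. path_weight d (x # h) * run d S (True # c) (x # h) * run d S (True # c') (x # h))
      = d x * pairing w (x # S) (x # S) c c'" for x
    unfolding pairing_def
    by (subst path_sum_scale[symmetric]) (auto intro!: path_sum_cong simp: field_simps)
  then show ?thesis unfolding pairing_def[of "k # w"] by simp
qed

text \<open>
  On a prefix where both words open, the two region stacks stay equal, so an identity for arbitrary equal
  stacks survives the summation over the walk along the prefix.
\<close>

lemma pairing_opens: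
  assumes "\<And>S. S \<noteq> [] \<Longrightarrow> pairing w S S c c' = a * pairing v S S e e'" and "S \<noteq> []"
  shows "pairing (u @ w) S S (replicate (length u) True @ c) (replicate (length u) True @ c') =
    a * pairing (u @ v) S S (replicate (length u) True @ e) (replicate (length u) True @ e')"
  using assms(2)
proof (induction u arbitrary: S)
  case Nil
  then show ?case using assms(1) by simp
next
  case (Cons k u)
  then show ?case by (simp add: pairing_open_open sum_distrib_left mult_ac)
qed

text \<open>
  The region inside the loop touches nothing else, so its label is summed freely: this is the eigenvector equation.
\<close>

lemma pairing_close:
  assumes "S \<noteq> []"
  shows "pairing (k # k # w) S S (True # False # c) (True # False # c') = t * pairing w S S c c'"
proof -
  obtain q S' where S: "S = q # S'" using assms by (cases S) auto
  have *: "pairing (k # w) (x # S) (x # S) (False # c) (False # c') = pairing w S S c c' / d q"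
    if x: "x \<in> nb k q" for x
  proof -
    have "pairing (k # w) (x # S) (x # S) (False # c) (False # c') =
      (\<Sum>y\<in>nb k x. path_sum nb b w y (\<lambda>h. if q = y then inverse (d q) *
          (path_weight d h * run d S c h * run d S c' h) else 0))"
      unfolding pairing_def using S by (auto intro!: sum.cong path_sum_cong simp: field_simps)
    also have "\<dots> = (\<Sum>y\<in>nb k x. if y = q then pairing w S S c c' / d q else 0)"
      by (rule sum.cong) (auto simp: path_sum_zero path_sum_scale pairing_def S divide_inverse)
    also have "\<dots> = pairing w S S c c' / d q"
      using nb_sym[OF x] by simp
    finally show ?thesis .
  qed
  have "pairing (k # k # w) S S (True # False # c) (True # False # c') =
     (\<Sum>x\<in>nb k q. d x * (pairing w S S c c' / d q))"
    unfolding pairing_open_open using * by (intro sum.cong) (auto simp: S)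
  also have "\<dots> = (t * d q) * (pairing w S S c c' / d q)"
    by (simp only: sum_distrib_right[symmetric] harmonic)
  finally show ?thesis by simp
qed

text \<open>
  On the left the letter after \<open>z1\<close> enters a fresh region from the region \<open>q\<close>. On the right the label \<open>x\<close> of that
  region has been chosen beforehand, and the letter returns to it. Only the term in which \<open>x\<close> is the vertex
  actually visited survives, and its factor \<open>d x\<close> is the price of the fresh region.
\<close>

lemma path_sum_straighten:
  assumes "balanced (length Q) z1" "length z1 = length w1"
  shows "path_sum nb b (w1 @ k # w2) (hd (Q @ [q]))
           (\<lambda>h. \<phi> h * run d (Q @ q # S) (z1 @ True # z2) h) =
    (\<Sum>x\<in>nb k q. d x * path_sum nb b (w1 @ k # w2) (hd (Q @ [q]))
           (\<lambda>h. \<phi> h * run d (Q @ q # x # q # S) (z1 @ False # z2) h))"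
  using assms
proof (induction z1 arbitrary: Q w1 \<phi>)
  case Nil
  then have [simp]: "Q = []" "w1 = []" by auto
  have pop: "path_sum nb b (k # w2) q (\<lambda>h. \<phi> h * run d (q # x # q # S) (False # z2) h) =
    (\<Sum>y\<in>nb k q. if y = x then path_sum nb b w2 x (\<lambda>h. \<phi> (x # h) * run d (x # q # S) z2 h) else 0)" for x
    unfolding path_sum.simps by (rule sum.cong) (auto simp: path_sum_zero)
  have "(\<Sum>x\<in>nb k q. d x * path_sum nb b (w1 @ k # w2) (hd (Q @ [q]))
           (\<lambda>h. \<phi> h * run d (Q @ q # x # q # S) ([] @ False # z2) h)) =
    (\<Sum>x\<in>nb k q. d x * path_sum nb b (k # w2) q (\<lambda>h. \<phi> h * run d (q # x # q # S) (False # z2) h))"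
    by simp
  also have "\<dots> = (\<Sum>x\<in>nb k q. path_sum nb b w2 x (\<lambda>h. d x * (\<phi> (x # h) * run d (x # q # S) z2 h)))"
    unfolding pop by (intro sum.cong refl) (simp add: path_sum_scale)
  also have "\<dots> = path_sum nb b (w1 @ k # w2) (hd (Q @ [q]))
           (\<lambda>h. \<phi> h * run d (Q @ q # S) ([] @ True # z2) h)"
    by (auto intro!: sum.cong path_sum_cong simp: mult_ac)
  finally show ?case by simp
next
  case (Cons e z1)
  then obtain l w1' where w1: "w1 = l # w1'" and len: "length z1 = length w1'" by (cases w1) auto
  show ?case
  proof (cases e)
    case True
    have bal: "balanced (length (y # Q)) z1" for y using Cons.prems True by simp
    have "path_sum nb b (w1 @ k # w2) (hd (Q @ [q])) (\<lambda>h. \<phi> h * run d (Q @ q # S) ((e # z1) @ True # z2) h)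
      = (\<Sum>y\<in>nb l (hd (Q @ [q])). path_sum nb b (w1' @ k # w2) (hd ((y # Q) @ [q]))
          (\<lambda>h. (\<phi> (y # h) * d y) * run d ((y # Q) @ q # S) (z1 @ True # z2) h))"
      using True w1 by (simp add: mult_ac)
    also have "\<dots> = (\<Sum>y\<in>nb l (hd (Q @ [q])). \<Sum>x\<in>nb k q. d x * path_sum nb b (w1' @ k # w2) (hd ((y # Q) @ [q]))
          (\<lambda>h. (\<phi> (y # h) * d y) * run d ((y # Q) @ q # x # q # S) (z1 @ False # z2) h))"
      by (intro sum.cong refl Cons.IH bal len)
    also have "\<dots> = (\<Sum>x\<in>nb k q. \<Sum>y\<in>nb l (hd (Q @ [q])). d x * path_sum nb b (w1' @ k # w2) (hd ((y # Q) @ [q]))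
          (\<lambda>h. (\<phi> (y # h) * d y) * run d ((y # Q) @ q # x # q # S) (z1 @ False # z2) h))"
      by (rule sum.swap)
    finally show ?thesis using True w1 by (simp add: sum_distrib_left mult_ac)
  next
    case False
    then obtain a Q' where Q: "Q = a # Q'" and bal: "balanced (length Q') z1"
      using Cons.prems by (cases Q) auto
    have e: "e = False" using False by simp
    define y where "y = hd (Q' @ [q])"
    have y: "hd (Q' @ q # X) = y" for X unfolding y_def by (cases Q') auto
    have pop: "path_sum nb b (w1 @ k # w2) (hd (Q @ [q])) (\<lambda>h. \<phi> h * run d (Q @ q # X) (False # c) h)
      = (if y \<in> nb l a then path_sum nb b (w1' @ k # w2) y (\<lambda>h. \<phi> (y # h) * run d (Q' @ q # X) c h) else 0)" for X c
    proof -
      have "path_sum nb b (w1 @ k # w2) (hd (Q @ [q])) (\<lambda>h. \<phi> h * run d (Q @ q # X) (False # c) h)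
        = (\<Sum>v\<in>nb l a. if v = y then path_sum nb b (w1' @ k # w2) y (\<lambda>h. \<phi> (y # h) * run d (Q' @ q # X) c h) else 0)"
        unfolding w1 Q append_Cons path_sum.simps list.sel
        by (rule sum.cong) (auto simp: y path_sum_zero)
      then show ?thesis by simp
    qed
    show ?thesis
      using Cons.IH[OF bal len, of "\<lambda>h. \<phi> (y # h)"]
      unfolding e append_Cons pop by (simp add: y_def)
  qed
qed

text \<open>
  The two letters removed make the walk step from \<open>q\<close> to a neighbour \<open>x\<close> and back. The first word enters two new regions
  there, labelled \<open>x\<close> and \<open>q\<close>, and the second word returns to \<open>q\<close>, so that the sum over \<open>x\<close> is the one
  in \<open>path_sum_straighten\<close>.
\<close>

lemma pairing_straighten:
  assumes "S \<noteq> []" "balanced 0 z1" "length z1 = length w1"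
  shows "pairing (k # k # w1 @ k # w2) S S (True # True # z1 @ False # z2) (True # False # c') =
     pairing (w1 @ k # w2) S S (z1 @ True # z2) c'"
proof -
  obtain q S' where S: "S = q # S'" using assms by (cases S) auto
  let ?w = "w1 @ k # w2"
  let ?\<phi> = "\<lambda>h. path_weight d h * run d S c' h"
  have *: "pairing (k # ?w) (x # S) (x # S) (True # z1 @ False # z2) (False # c') =
      path_sum nb b ?w q (\<lambda>h. ?\<phi> h * run d (q # x # q # S') (z1 @ False # z2) h)"
    if x: "x \<in> nb k q" for x
  proof -
    have "pairing (k # ?w) (x # S) (x # S) (True # z1 @ False # z2) (False # c') =
      (\<Sum>y\<in>nb k x. path_sum nb b ?w y (\<lambda>h. if q = y then
          (?\<phi> h * run d (q # x # q # S') (z1 @ False # z2) h) else 0))"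
      unfolding pairing_def using S by (auto intro!: sum.cong path_sum_cong simp: field_simps)
    also have "\<dots> = (\<Sum>y\<in>nb k x. if y = q then
        path_sum nb b ?w q (\<lambda>h. ?\<phi> h * run d (q # x # q # S') (z1 @ False # z2) h) else 0)"
      by (rule sum.cong) (auto simp: path_sum_zero)
    finally show ?thesis using nb_sym[OF x] by simp
  qed
  have "pairing (k # k # ?w) S S (True # True # z1 @ False # z2) (True # False # c') =
     (\<Sum>x\<in>nb k q. d x * path_sum nb b ?w q (\<lambda>h. ?\<phi> h * run d (q # x # q # S') (z1 @ False # z2) h))"
    unfolding pairing_open_open using * by (intro sum.cong) (auto simp: S)
  also have "\<dots> = path_sum nb b ?w q (\<lambda>h. ?\<phi> h * run d (q # S') (z1 @ True # z2) h)"
    using path_sum_straighten[of "[]" z1 w1 k w2 q ?\<phi> S' z2] assms by simp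
  also have "\<dots> = pairing ?w S S (z1 @ True # z2) c'"
    unfolding pairing_def S by (simp add: mult_ac)
  finally show ?thesis .
qed

text \<open>
  Any two graphs with the same eigenvalue give the same state sums, and a single value of \<open>t\<close>, other than
  a root of unity or zero, already determines the number of loops.
\<close>

theorem pairing_loop_count:
  "loop_count w c c' l \<Longrightarrow> pairing w [b] [b] c c' = t ^ l"
proof (induction rule: loop_count.induct)
  case empty
  then show ?case by (simp add: pairing_def)
next
  case (close u w c c' l k)
  then show ?case
    using pairing_opens[where u = u and S = "[b]" and a = t, OF pairing_close] by simp
next
  case (straighten u w1 k w2 z1 z2 c' l)
  then show ?case
    using pairing_opens[where u = u and S = "[b]" and a = 1] pairing_straighten by (smt (verit, best) list.distinct(1) mult_1)
next
  case (sym w c c' l)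
  then show ?case using pairing_commute by metis
qed

end

section \<open>Even noncrossing partitions as words\<close>

text \<open>
  Neighbouring points carry the two colours in opposite orders, so that an arc from the second end of a point to the first
  end of a later one requires the two points to have opposite parity.
\<close>

fun point_word :: "nat \<Rightarrow> nat \<Rightarrow> bool list" where
  "point_word 0 j = []"
| "point_word (Suc m) j = odd j # even j # point_word m (Suc j)"

text \<open>
  The passage from a partition to a word, read from left to right. In \<open>sweep m j Os R c\<close> the points from \<open>j\<close> to
  \<open>j + m - 1\<close> are still to come, \<open>Os\<close> lists the parts found so far of the unfinished
  blocks, the most recent one first, and \<open>R\<close> consists of the completed forms of the blocks that end at \<open>j\<close> or later. Each point
  contributes two letters of \<open>c\<close>: the first closes an arc if the point continues a block, the second opens one
  if the block continues beyond the point. A point that forms a block of its own would not be even.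
\<close>

inductive sweep :: "nat \<Rightarrow> nat \<Rightarrow> nat set list \<Rightarrow> nat set set \<Rightarrow> bool list \<Rightarrow> bool" where
  finish: "sweep 0 j [] {} []"
| open_block: "sweep (Suc m) j Os R (True # True # c)" if "sweep m (Suc j) ({j} # Os) R c"
| extend: "sweep (Suc m) j (X # Os) R (False # True # c)" if "sweep m (Suc j) (insert j X # Os) R c"
| close_block: "sweep (Suc m) j (X # Os) (insert (insert j X) R) (False # False # c)"
  if "sweep m (Suc j) Os R c" "even (card (insert j X))"

text \<open>
  Two unfinished blocks both have points to come, so they would cross if their points so far interleaved. Hence the more
  recent one lies entirely to the right of the other.
\<close>

definition open_stack :: "nat \<Rightarrow> nat set list \<Rightarrow> bool" where
  "open_stack j Os \<longleftrightarrow> (\<forall>X\<in>set Os. X \<noteq> {} \<and> X \<subseteq> {1..<j}) \<and> sorted_wrt (\<lambda>X Y. \<forall>x\<in>X. \<forall>y\<in>Y. y < x) Os"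

lemma open_stack_Nil: "open_stack j []"
  by (simp add: open_stack_def)

lemma open_stack_Cons:
  "open_stack j (X # Os) \<longleftrightarrow>
     X \<noteq> {} \<and> X \<subseteq> {1..<j} \<and> (\<forall>Y\<in>set Os. \<forall>x\<in>X. \<forall>y\<in>Y. y < x) \<and> open_stack j Os"
  unfolding open_stack_def sorted_wrt.simps list.set ball_simps by blast

lemma open_stackD: "open_stack j Os \<Longrightarrow> X \<in> set Os \<Longrightarrow> X \<noteq> {} \<and> X \<subseteq> {1..<j}"
  by (simp add: open_stack_def)

lemma open_stack_Suc: "open_stack j Os \<Longrightarrow> open_stack (Suc j) Os"
  unfolding open_stack_def by (auto simp: subset_iff less_SucI)

lemma open_stack_open:
  assumes "open_stack j Os" "0 < j"
  shows "open_stack (Suc j) ({j} # Os)"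
  using assms open_stack_Suc[OF assms(1)] open_stackD[OF assms(1)]
  unfolding open_stack_Cons by (simp add: subset_iff)

lemma open_stack_extend:
  assumes "open_stack j (X # Os)"
  shows "open_stack (Suc j) (insert j X # Os)"
proof -
  from assms have X: "X \<noteq> {}" "X \<subseteq> {1..<j}" and less: "\<forall>Y\<in>set Os. \<forall>x\<in>X. \<forall>y\<in>Y. y < x"
    and Os: "open_stack j Os" by (simp_all add: open_stack_Cons)
  have "0 < j" using X by force
  moreover have "y < j" if "Y \<in> set Os" "y \<in> Y" for y Y
    using open_stackD[OF Os that(1)] that(2) by auto
  ultimately show ?thesis
    unfolding open_stack_Cons using X less open_stack_Suc[OF Os] by (simp add: subset_iff less_SucI)
qed

lemma open_stack_close: "open_stack j (X # Os) \<Longrightarrow> open_stack (Suc j) Os"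
  by (simp add: open_stack_Cons open_stack_Suc)

definition opened_size :: "nat set list \<Rightarrow> nat" where
  "opened_size Os = sum_list (map card Os)"

text \<open>
  An unfinished block keeps two arcs open, the outer one from the first end at its least point and the inner one from the second
  end at its latest point. The parities of these points give the colours. Finished blocks are even, so the
  parity of a point is that of the number of points of unfinished blocks up to that moment.
\<close>

fun colour_stack :: "nat set list \<Rightarrow> bool list" where
  "colour_stack [] = []"
| "colour_stack (X # Os) = even (opened_size (X # Os)) # even (opened_size Os) # colour_stack Os"

lemma opened_size_simps [simp]:
  "opened_size [] = 0" "opened_size (X # Os) = card X + opened_size Os"
  by (simp_all add: opened_size_def)

lemma open_stack_card_insert:
  "open_stack j (X # Os) \<Longrightarrow> card (insert j X) = Suc (card X)"
  unfolding open_stack_Cons by (subst card_insert_disjoint) (auto intro: finite_subset)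

text \<open>
  The next point \<open>j\<close> has parity opposite to \<open>opened_size Os\<close>. Therefore the inner arc of the most recent block
  always has the colour of the first end at \<open>j\<close>, while its outer arc has the colour of the second end if and only if
  closing the block there makes it even.
\<close>

lemma sweep_admissible:
  assumes "sweep m j Os R c" "open_stack j Os" "j > 0" "odd (j + opened_size Os)"
  shows "admissible (colour_stack Os) (point_word m j) c"
  using assms
proof (induction rule: sweep.induct)
  case (finish j)
  then show ?case by simp
next
  case (open_block m j Os R c)
  then show ?case using open_stack_open[of j Os] by auto
next
  case (extend m j X Os R c)
  then show ?case using open_stack_extend[of j X Os] open_stack_card_insert[of j X Os] by auto
next
  case (close_block m j Os R c X)
  then show ?case using open_stack_close[of j X Os] open_stack_card_insert[of j X Os] by auto
qed

lemma admissible_sweep: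
  assumes "admissible (colour_stack Os) (point_word m j) c" "open_stack j Os" "j > 0" "odd (j + opened_size Os)"
  shows "\<exists>R. sweep m j Os R c"
  using assms
proof (induction m arbitrary: j Os c)
  case 0
  then have "Os = []" "c = []" by (cases Os; cases c; simp)+
  then show ?case using sweep.finish by blast
next
  case (Suc m)
  then obtain e1 e2 c' where c: "c = e1 # e2 # c'"
    by (cases c; cases "tl c"; cases "hd c") auto
  show ?case
  proof (cases e1)
    case True
    then have "e2" using Suc.prems c by (cases e2) auto
    have "\<exists>R. sweep m (Suc j) ({j} # Os) R c'"
      by (rule Suc.IH) (use True \<open>e2\<close> c Suc.prems open_stack_open[of j Os] in auto)
    then show ?thesis using True \<open>e2\<close> c by (auto intro: sweep.open_block)
  next
    case False
    then obtain X Os' where Os: "Os = X # Os'" using Suc.prems c by (cases Os) auto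
    note card = open_stack_card_insert[of j X Os']
    show ?thesis
    proof (cases e2)
      case True
      have "\<exists>R. sweep m (Suc j) (insert j X # Os') R c'"
        by (rule Suc.IH) (use True False c Os Suc.prems card open_stack_extend[of j X Os'] in auto)
      then show ?thesis using True False c Os by (auto intro: sweep.extend)
    next
      case e2: False
      have even: "even (card (insert j X))" and "admissible (colour_stack Os') (point_word m (Suc j)) c'"
        using e2 False c Os Suc.prems card by auto
      then have "\<exists>R. sweep m (Suc j) Os' R c'"
        by (intro Suc.IH) (use e2 False c Os Suc.prems card open_stack_close[of j X Os'] in auto)
      then show ?thesis using e2 False c Os even by (auto intro: sweep.close_block)
    qed
  qed
qed

text \<open>
  All claims are proved together by following the sweep backwards. The crux is that a block closed at \<open>j\<close> can cross no
  block closed later, because the points of the latter up to \<open>j\<close> lie below all points of the former.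
\<close>

lemma sweep_blocks:
  assumes "sweep m j Os R c" "open_stack j Os" "j > 0"
  shows "B \<in> R \<Longrightarrow> B \<inter> {..<j} = {} \<or> B \<inter> {..<j} \<in> set Os"
    and "X \<in> set Os \<Longrightarrow> \<exists>B\<in>R. B \<inter> {..<j} = X \<and> B \<inter> {j..} \<noteq> {}"
    and "\<Union>R = \<Union>(set Os) \<union> {j..<j + m}"
    and "disjoint R" and "{} \<notin> R" and "finite R"
    and "noncrossing R" and "B \<in> R \<Longrightarrow> even (card B)"
proof -
  have "(\<forall>B\<in>R. B \<inter> {..<j} = {} \<or> B \<inter> {..<j} \<in> set Os) \<and>
    (\<forall>X\<in>set Os. \<exists>B\<in>R. B \<inter> {..<j} = X \<and> B \<inter> {j..} \<noteq> {}) \<and>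
    \<Union>R = \<Union>(set Os) \<union> {j..<j + m} \<and> disjoint R \<and> {} \<notin> R \<and> finite R \<and> noncrossing R \<and> (\<forall>B\<in>R. even (card B))"
    using assms
  proof (induction rule: sweep.induct)
    case (finish j)
    then show ?case by (auto simp: noncrossing_def)
  next
    case (open_block m j Os R c)
    note IH = open_block.IH[OF open_stack_open[OF open_block.prems] zero_less_Suc]
    have sub: "Y \<subseteq> {..<j}" if "Y \<in> set Os" for Y
      using open_stackD[OF open_block.prems(1) that] by auto
    have "B \<inter> {..<j} = {} \<or> B \<inter> {..<j} \<in> set Os" if "B \<in> R" for B
    proof -
      have "B \<inter> {..<j} = B \<inter> {..<Suc j} \<inter> {..<j}" by auto
      moreover from IH that have "B \<inter> {..<Suc j} = {} \<or> B \<inter> {..<Suc j} = {j} \<or> B \<inter> {..<Suc j} \<in> set Os" by auto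
      ultimately show ?thesis using sub by (metis Int_absorb2 Int_empty_left Int_insert_left lessThan_iff less_irrefl)
    qed
    moreover have "\<exists>B\<in>R. B \<inter> {..<j} = X \<and> B \<inter> {j..} \<noteq> {}" if mem: "X \<in> set Os" for X
    proof -
      obtain B where B: "B \<in> R" "B \<inter> {..<Suc j} = X" "B \<inter> {Suc j..} \<noteq> {}"
        using IH[THEN conjunct2, THEN conjunct1, THEN bspec, of X] mem by auto
      have "B \<inter> {..<j} = X" using B(2) sub[OF mem] by auto
      then show ?thesis using B by force
    qed
    moreover have "\<Union>(set ({j} # Os)) \<union> {Suc j..<Suc j + m} = \<Union>(set Os) \<union> {j..<j + Suc m}" by auto
    ultimately show ?case using IH by auto
  next
    case (extend m j X Os R c)
    note IH = extend.IH[OF open_stack_extend[OF extend.prems(1)] zero_less_Suc]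
    have sub: "Y \<subseteq> {..<j}" if "Y \<in> set (X # Os)" for Y
      using open_stackD[OF extend.prems(1) that] by auto
    have "B \<inter> {..<j} = {} \<or> B \<inter> {..<j} \<in> set (X # Os)" if "B \<in> R" for B
    proof -
      have "B \<inter> {..<j} = B \<inter> {..<Suc j} \<inter> {..<j}" by auto
      moreover from IH that have "B \<inter> {..<Suc j} = {} \<or> B \<inter> {..<Suc j} = insert j X \<or> B \<inter> {..<Suc j} \<in> set Os" by auto
      moreover have "insert j X \<inter> {..<j} = X" using sub[of X] by auto
      ultimately show ?thesis using sub by (metis Int_absorb2 Int_empty_left list.set_intros)
    qed
    moreover have "\<exists>B\<in>R. B \<inter> {..<j} = Y \<and> B \<inter> {j..} \<noteq> {}" if mem: "Y \<in> set (X # Os)" for Y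
    proof (cases "Y = X")
      case True
      obtain B where B: "B \<in> R" "B \<inter> {..<Suc j} = insert j X"
        using IH[THEN conjunct2, THEN conjunct1, THEN bspec, of "insert j X"] by auto
      have "B \<inter> {..<j} = B \<inter> {..<Suc j} \<inter> {..<j}" by auto
      also have "\<dots> = X" using B(2) sub[of X] by auto
      finally have "B \<inter> {..<j} = X" .
      moreover have "j \<in> B" using B(2) by auto
      ultimately show ?thesis using B(1) True by force
    next
      case False
      obtain B where B: "B \<in> R" "B \<inter> {..<Suc j} = Y" "B \<inter> {Suc j..} \<noteq> {}"
        using IH[THEN conjunct2, THEN conjunct1, THEN bspec, of Y] mem False by auto
      have "B \<inter> {..<j} = Y" using B(2) sub[OF mem] by auto
      then show ?thesis using B by force
    qed
    moreover have "\<Union>(set (insert j X # Os)) \<union> {Suc j..<Suc j + m} = \<Union>(set (X # Os)) \<union> {j..<j + Suc m}" by auto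
    ultimately show ?case using IH by auto
  next
    case (close_block m j Os R c X)
    note IH = close_block.IH[OF open_stack_close[OF close_block.prems(1)] zero_less_Suc]
    have sub: "Y \<subseteq> {..<j}" if "Y \<in> set (X # Os)" for Y
      using open_stackD[OF close_block.prems(1) that] by auto
    have above: "y < x" if "Y \<in> set Os" "x \<in> X" "y \<in> Y" for x y Y
      using that close_block.prems(1) unfolding open_stack_Cons by blast
    have X: "X \<noteq> {}" using close_block.prems(1) unfolding open_stack_Cons by blast
    \<comment> \<open>the later blocks meet the initial segment only below the block that is closed now\<close>
    have gap: "(\<forall>x\<in>insert j X. y < x) \<or> j < y" if "B \<in> R" "y \<in> B" for B y
    proof (cases "y \<le> j")
      case True
      then have "y \<in> B \<inter> {..<Suc j}" using that by auto
      then have Y: "B \<inter> {..<Suc j} \<in> set Os" using IH that by (metis empty_iff)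
      then have "y < j" using sub[of "B \<inter> {..<Suc j}"] \<open>y \<in> B \<inter> {..<Suc j}\<close> by auto
      then show ?thesis using above[OF Y _ \<open>y \<in> B \<inter> {..<Suc j}\<close>] by auto
    qed auto
    have le: "x \<le> j" if "x \<in> insert j X" for x using that sub[of X] by auto
    have new: "insert j X \<inter> B = {}" if "B \<in> R" for B
    proof (rule ccontr)
      assume "insert j X \<inter> B \<noteq> {}"
      then obtain z where z: "z \<in> insert j X" "z \<in> B" by blast
      then show False using gap[OF that z(2)] le[OF z(1)] by auto
    qed
    have "B \<inter> {..<j} = {} \<or> B \<inter> {..<j} \<in> set (X # Os)" if "B \<in> insert (insert j X) R" for B
    proof (cases "B = insert j X")
      case True
      then have "B \<inter> {..<j} = X" using sub[of X] by auto
      then show ?thesis by simp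
    next
      case False
      then have "B \<in> R" using that by simp
      then have "j \<notin> B" using new by blast
      then have "B \<inter> {..<j} = B \<inter> {..<Suc j}" by (auto simp: less_Suc_eq)
      then show ?thesis using IH \<open>B \<in> R\<close> by auto
    qed
    moreover have "\<exists>B\<in>insert (insert j X) R. B \<inter> {..<j} = Y \<and> B \<inter> {j..} \<noteq> {}" if mem: "Y \<in> set (X # Os)" for Y
    proof (cases "Y = X")
      case True
      have "insert j X \<inter> {..<j} = Y" using True sub[of X] by auto
      then show ?thesis by blast
    next
      case False
      obtain B where B: "B \<in> R" "B \<inter> {..<Suc j} = Y" "B \<inter> {Suc j..} \<noteq> {}"
        using IH[THEN conjunct2, THEN conjunct1, THEN bspec, of Y] mem False by auto
      have "B \<inter> {..<j} = Y" using B(2) sub[OF mem] by auto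
      then show ?thesis using B by force
    qed
    moreover have "\<Union>(insert (insert j X) R) = \<Union>(set (X # Os)) \<union> {j..<j + Suc m}"
    proof -
      have "\<Union>(insert (insert j X) R) = insert j X \<union> (\<Union>(set Os) \<union> {Suc j..<Suc j + m})" using IH by auto
      then show ?thesis by auto
    qed
    moreover have "disjoint (insert (insert j X) R)"
      using IH new unfolding disjoint_def by (simp add: Int_commute)
    moreover have "noncrossing (insert (insert j X) R)"
      unfolding noncrossing_def
    proof (intro notI, elim bexE conjE)
      fix B C a b a' b'
      assume BC: "B \<in> insert (insert j X) R" "C \<in> insert (insert j X) R" "B \<noteq> C"
        and ab: "a \<in> B" "b \<in> C" "a' \<in> B" "b' \<in> C" "a < b" "b < a'" "a' < b'"
      consider "B \<in> R" "C \<in> R" | "B = insert j X" "C \<in> R" | "B \<in> R" "C = insert j X"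
        using BC by auto
      then show False
      proof cases
        case 1
        then have "\<exists>B\<in>R. \<exists>C\<in>R. B \<noteq> C \<and> (\<exists>i\<in>B. \<exists>j\<in>C. \<exists>k\<in>B. \<exists>l\<in>C. i < j \<and> j < k \<and> k < l)"
          using BC(3) ab by (intro bexI[of _ B] bexI[of _ C] bexI[of _ a] bexI[of _ b] bexI[of _ a'] bexI[of _ b'] conjI)
        moreover have "noncrossing R" using IH by blast
        ultimately show ?thesis unfolding noncrossing_def by (rule notE[rotated])
      next
        case 2
        have "b < a \<or> j < b" using gap[OF 2(2) ab(2)] ab(1) 2(1) by blast
        moreover have "a' \<le> j" using le ab(3) 2(1) by blast
        ultimately show ?thesis using ab by linarith
      next
        case 3
        have "a' < b \<or> j < a'" using gap[OF 3(1) ab(3)] ab(2) 3(2) by blast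
        moreover have "b' \<le> j" using le ab(4) 3(2) by blast
        ultimately show ?thesis using ab by linarith
      qed
    qed
    ultimately show ?case using IH close_block.hyps by auto
  qed
  then show "B \<in> R \<Longrightarrow> B \<inter> {..<j} = {} \<or> B \<inter> {..<j} \<in> set Os"
    and "X \<in> set Os \<Longrightarrow> \<exists>B\<in>R. B \<inter> {..<j} = X \<and> B \<inter> {j..} \<noteq> {}"
    and "\<Union>R = \<Union>(set Os) \<union> {j..<j + m}"
    and "disjoint R" and "{} \<notin> R" and "finite R"
    and "noncrossing R" and "B \<in> R \<Longrightarrow> even (card B)" by blast+
qed

lemma sweep_unique:
  "sweep m j Os R c \<Longrightarrow> sweep m j Os R' c \<Longrightarrow> R' = R"
proof (induction arbitrary: R' rule: sweep.induct)
  case (finish j)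
  then show ?case by cases auto
next
  case (open_block m j Os R c)
  from open_block.prems show ?case by cases (use open_block.IH in auto)
next
  case (extend m j X Os R c)
  from extend.prems show ?case by cases (use extend.IH in auto)
next
  case (close_block m j Os R c X)
  from close_block.prems show ?case by cases (use close_block.IH in auto)
qed

text \<open>
  The word can also be read off from the blocks directly, point by point; this makes it a function of the partition.
\<close>

definition opens :: "nat set set \<Rightarrow> nat \<Rightarrow> bool" where
  "opens R i \<longleftrightarrow> (\<exists>B\<in>R. i \<in> B \<and> (\<forall>x\<in>B. i \<le> x))"

definition continues :: "nat set set \<Rightarrow> nat \<Rightarrow> bool" where
  "continues R i \<longleftrightarrow> (\<exists>B\<in>R. i \<in> B \<and> (\<exists>x\<in>B. i < x))"

fun partition_code :: "nat set set \<Rightarrow> nat \<Rightarrow> nat \<Rightarrow> bool list" where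
  "partition_code R 0 j = []"
| "partition_code R (Suc m) j = opens R j # continues R j # partition_code R m (Suc j)"

lemma partition_code_insert:
  assumes "A \<subseteq> {..<j}"
  shows "partition_code (insert A R) m j = partition_code R m j"
  using assms
proof (induction m arbitrary: j)
  case (Suc m)
  then have "j \<notin> A" "A \<subseteq> {..<Suc j}" by auto
  then show ?case using Suc.IH by (simp add: opens_def continues_def)
qed simp

lemma sweep_partition_code:
  assumes "sweep m j Os R c" "open_stack j Os" "j > 0"
  shows "c = partition_code R m j"
  using assms
proof (induction rule: sweep.induct)
  case (finish j)
  then show ?case by simp
next
  case (open_block m j Os R c)
  note st = open_stack_open[OF open_block.prems]
  obtain B where B: "B \<in> R" "B \<inter> {..<Suc j} = {j}" "B \<inter> {Suc j..} \<noteq> {}"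
    using sweep_blocks(2)[OF open_block.hyps st, of "{j}"] by auto
  have "j \<in> B" using B(2) by blast
  moreover have "j \<le> x" if "x \<in> B" for x
  proof (rule ccontr)
    assume "\<not> j \<le> x"
    then have "x \<in> B \<inter> {..<Suc j}" using that by auto
    then show False using B(2) \<open>\<not> j \<le> x\<close> by auto
  qed
  moreover have "\<exists>x\<in>B. j < x" using B(3) by force
  ultimately have "opens R j" "continues R j" using B(1) unfolding opens_def continues_def by blast+
  then show ?case using open_block.IH[OF st] by simp
next
  case (extend m j X Os R c)
  note st = open_stack_extend[OF extend.prems(1)]
  obtain B where B: "B \<in> R" "B \<inter> {..<Suc j} = insert j X" "B \<inter> {Suc j..} \<noteq> {}"
    using sweep_blocks(2)[OF extend.hyps st, of "insert j X"] by auto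
  have disj: "disjoint R" by (rule sweep_blocks(4)[OF extend.hyps st]) simp
  have "j \<in> B" using B(2) by blast
  obtain x where x: "x \<in> X" "x < j"
    using extend.prems(1) unfolding open_stack_Cons by fastforce
  then have "x \<in> B" using B(2) by blast
  have "\<not> opens R j"
    unfolding opens_def using disjointD[OF disj B(1)] \<open>j \<in> B\<close> \<open>x \<in> B\<close> x(2)
    by (metis disjoint_iff not_le)
  moreover have "\<exists>x\<in>B. j < x" using B(3) by force
  then have "continues R j" using B(1) \<open>j \<in> B\<close> unfolding continues_def by blast
  ultimately show ?case using extend.IH[OF st] by simp
next
  case (close_block m j Os R c X)
  note st = open_stack_close[OF close_block.prems(1)]
  let ?A = "insert j X"
  have sw: "sweep (Suc m) j (X # Os) (insert ?A R) (False # False # c)"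
    by (rule sweep.close_block) (use close_block.hyps in auto)
  have disj: "disjoint (insert ?A R)" by (rule sweep_blocks(4)[OF sw close_block.prems])
  have X: "X \<noteq> {}" "X \<subseteq> {..<j}" using close_block.prems(1) unfolding open_stack_Cons by auto
  have only: "B = ?A" if "B \<in> insert ?A R" "j \<in> B" for B
    using disjointD[OF disj that(1), of ?A] that(2) by blast
  obtain x where x: "x \<in> X" "x < j" using X by blast
  have "\<not> opens (insert ?A R) j" unfolding opens_def using only x by (metis insertCI not_le)
  moreover have "\<not> continues (insert ?A R) j"
  proof
    assume "continues (insert ?A R) j"
    then obtain B y where "B \<in> insert ?A R" "j \<in> B" "y \<in> B" "j < y" unfolding continues_def by blast
    then have "y \<in> ?A" using only by blast
    then show False using X(2) \<open>j < y\<close> by auto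
  qed
  moreover have "partition_code (insert ?A R) m (Suc j) = partition_code R m (Suc j)"
    by (rule partition_code_insert) (use X in auto)
  ultimately show ?case using close_block.IH[OF st] by simp
qed

text \<open>
  For a given partition, the unfinished blocks before \<open>j\<close> are the traces of the blocks that span \<open>j\<close>.
\<close>

definition spanning :: "nat set set \<Rightarrow> nat \<Rightarrow> nat set set" where
  "spanning P j = {B \<in> P. B \<inter> {..<j} \<noteq> {} \<and> B \<inter> {j..} \<noteq> {}}"

lemma spanning_Suc:
  assumes part: "partition_on A P" and B: "B \<in> P" "j \<in> B"
  shows "spanning P (Suc j) = (spanning P j - {B}) \<union> (if B \<inter> {Suc j..} \<noteq> {} then {B} else {})"
    and "(\<lambda>C. C \<inter> {..<Suc j}) ` (spanning P j - {B}) = (\<lambda>C. C \<inter> {..<j}) ` (spanning P j - {B})"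
    and "{C \<in> P. C \<inter> {j..} \<noteq> {}} = insert B {C \<in> P. C \<inter> {Suc j..} \<noteq> {}}"
proof -
  have other: "j \<notin> C" if "C \<in> P" "C \<noteq> B" for C
    using that B partition_onD2[OF part] by (meson disjointD disjoint_iff)
  have cut: "C \<inter> {..<Suc j} = C \<inter> {..<j}" "C \<inter> {Suc j..} = C \<inter> {j..}" if "C \<in> P" "C \<noteq> B" for C
  proof -
    have "j \<notin> C" using other that by blast
    then show "C \<inter> {..<Suc j} = C \<inter> {..<j}" "C \<inter> {Suc j..} = C \<inter> {j..}"
      by (auto simp: less_Suc_eq Suc_le_eq order.order_iff_strict)
  qed
  have BS: "B \<inter> {..<Suc j} \<noteq> {}" "B \<inter> {j..} \<noteq> {}" using B(2) by auto
  show "spanning P (Suc j) = (spanning P j - {B}) \<union> (if B \<inter> {Suc j..} \<noteq> {} then {B} else {})"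
  proof (rule Set.set_eqI)
    fix C
    show "C \<in> spanning P (Suc j) \<longleftrightarrow> C \<in> (spanning P j - {B}) \<union> (if B \<inter> {Suc j..} \<noteq> {} then {B} else {})"
    proof (cases "C = B")
      case True
      then show ?thesis using BS B(1) by (simp add: spanning_def del: atLeast_Suc)
    next
      case False
      then have "C \<in> spanning P (Suc j) \<longleftrightarrow> C \<in> spanning P j"
        unfolding spanning_def mem_Collect_eq using cut[of C] by metis
      then show ?thesis using False by simp
    qed
  qed
  show "(\<lambda>C. C \<inter> {..<Suc j}) ` (spanning P j - {B}) = (\<lambda>C. C \<inter> {..<j}) ` (spanning P j - {B})"
    by (rule image_cong) (use cut(1) in \<open>simp_all add: spanning_def\<close>)
  show "{C \<in> P. C \<inter> {j..} \<noteq> {}} = insert B {C \<in> P. C \<inter> {Suc j..} \<noteq> {}}"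
  proof (rule Set.set_eqI)
    fix C
    show "C \<in> {C \<in> P. C \<inter> {j..} \<noteq> {}} \<longleftrightarrow> C \<in> insert B {C \<in> P. C \<inter> {Suc j..} \<noteq> {}}"
      unfolding mem_Collect_eq insert_iff using cut(2)[of C] BS(2) B(1) by metis
  qed
qed

text \<open>
  Every even noncrossing partition can be swept. The point at issue is that a point which continues a block must find that block
  on top of the list of unfinished ones.
\<close>

lemma ex_sweep_from:
  assumes part: "partition_on {1..k} P" and nc: "noncrossing P" and even: "\<forall>B\<in>P. even (card B)"
    and "j + m = Suc k" "1 \<le> j" "sorted_wrt (\<lambda>X Y. \<forall>x\<in>X. \<forall>y\<in>Y. y < x) Os"
    and "set Os = (\<lambda>B. B \<inter> {..<j}) ` spanning P j"
  shows "\<exists>c. sweep m j Os {B \<in> P. B \<inter> {j..} \<noteq> {}} c"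
  using assms(4-)
proof (induction m arbitrary: j Os)
  case 0
  have le: "x \<le> k" if "B \<in> P" "x \<in> B" for B x
    using partition_onD1[OF part] that by auto
  have "B \<inter> {j..} = {}" if "B \<in> P" for B
    using le[OF that] 0 by force
  then have none: "{B \<in> P. B \<inter> {j..} \<noteq> {}} = {}" "spanning P j = {}" by (auto simp: spanning_def)
  then have "Os = []" using 0 by simp
  then show ?case unfolding none using sweep.finish by blast
next
  case (Suc m)
  have "j \<in> {1..k}" using Suc.prems by auto
  then have "j \<in> \<Union>P" unfolding partition_onD1[OF part] .
  then obtain B where B: "B \<in> P" "j \<in> B" by blast
  note span = spanning_Suc[OF part B]
  have below: "y < j" if "Y \<in> set Os" "y \<in> Y" for y Y
    using that Suc.prems(4) by auto
  have Bsub: "B \<subseteq> {..<j} \<union> {j} \<union> {Suc j..}" by (auto simp: Suc_le_eq)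
  have later: "j < x" if "x \<in> C" "x \<notin> {..<j}" "C \<in> P" "C \<noteq> B" for x C
  proof -
    have "x \<noteq> j" using that B partition_onD2[OF part] by (metis disjointD disjoint_iff)
    then show ?thesis using that(2) by auto
  qed
  show ?case
  proof (cases "B \<inter> {..<j} = {}")
    case True
    have cont: "B \<inter> {Suc j..} \<noteq> {}"
    proof
      assume "B \<inter> {Suc j..} = {}"
      then have "B = {j}" using True Bsub B(2) by blast
      then show False using even B(1) by auto
    qed
    have "B \<notin> spanning P j" using True by (simp add: spanning_def)
    have "B \<inter> {..<Suc j} = {j}" using True B(2) by (auto simp: less_Suc_eq)
    then have "set ({j} # Os) = (\<lambda>B. B \<inter> {..<Suc j}) ` spanning P (Suc j)"
      unfolding span(1) using span(2) \<open>B \<notin> spanning P j\<close> cont Suc.prems(4) by simp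
    moreover have "sorted_wrt (\<lambda>X Y. \<forall>x\<in>X. \<forall>y\<in>Y. y < x) ({j} # Os)"
      using Suc.prems(3) below by simp
    ultimately obtain c where "sweep m (Suc j) ({j} # Os) {B \<in> P. B \<inter> {Suc j..} \<noteq> {}} c"
      using Suc.IH[of "Suc j" "{j} # Os"] Suc.prems by auto
    moreover have "{C \<in> P. C \<inter> {j..} \<noteq> {}} = {B \<in> P. B \<inter> {Suc j..} \<noteq> {}}"
      unfolding span(3) using B(1) cont by blast
    ultimately show ?thesis using sweep.open_block by metis
  next
    case False
    define X where "X = B \<inter> {..<j}"
    have Bspan: "B \<in> spanning P j" using False B by (auto simp: spanning_def)
    then have XOs: "X \<in> set Os" unfolding X_def Suc.prems(4) by blast
    obtain x where x: "x \<in> X" using False X_def by blast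
    \<comment> \<open>a more recently opened block would have to cross the block of the current point\<close>
    obtain Os' where Os: "Os = X # Os'"
    proof -
      obtain Y Os' where YOs: "Os = Y # Os'" using XOs by (cases Os) auto
      have "Y = X"
      proof (rule ccontr)
        assume "Y \<noteq> X"
        then have "X \<in> set Os'" using XOs YOs by auto
        have "Y \<in> (\<lambda>B. B \<inter> {..<j}) ` spanning P j"
          unfolding Suc.prems(4)[symmetric] YOs by simp
        then obtain C where C: "C \<in> spanning P j" "Y = C \<inter> {..<j}" by blast
        then have "C \<noteq> B" "C \<in> P" using \<open>Y \<noteq> X\<close> X_def by (auto simp: spanning_def)
        obtain y where y: "y \<in> C" "y < j" using C by (auto simp: spanning_def)
        then have "x < y" using \<open>X \<in> set Os'\<close> x Suc.prems(3) YOs C(2) by auto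
        obtain z where z: "z \<in> C" "j \<le> z" using C by (auto simp: spanning_def)
        then have "j < z" using later[OF z(1) _ \<open>C \<in> P\<close> \<open>C \<noteq> B\<close>] by auto
        have "x \<in> B" using x X_def by blast
        have "\<exists>B\<in>P. \<exists>C\<in>P. B \<noteq> C \<and> (\<exists>i\<in>B. \<exists>j\<in>C. \<exists>k\<in>B. \<exists>l\<in>C. i < j \<and> j < k \<and> k < l)"
          using B \<open>C \<in> P\<close> \<open>C \<noteq> B\<close>[symmetric] \<open>x \<in> B\<close> y z(1) \<open>x < y\<close> \<open>j < z\<close>
          by (intro bexI[of _ B] bexI[of _ C] bexI[of _ x] bexI[of _ y] bexI[of _ j] bexI[of _ z] conjI)
        then show False using nc unfolding noncrossing_def by (rule notE[rotated])
      qed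
      then show ?thesis using that YOs by blast
    qed
    have "X \<notin> set Os'" using Suc.prems(3) Os x by auto
    have inj: "inj_on (\<lambda>C. C \<inter> {..<j}) (spanning P j)"
    proof (rule inj_onI)
      fix C D assume "C \<in> spanning P j" "D \<in> spanning P j" "C \<inter> {..<j} = D \<inter> {..<j}"
      then show "C = D" using partition_onD2[OF part] unfolding spanning_def disjoint_def by blast
    qed
    have "set Os' = set Os - {X}" using Os \<open>X \<notin> set Os'\<close> by auto
    also have "\<dots> = (\<lambda>C. C \<inter> {..<j}) ` (spanning P j - {B})"
      unfolding Suc.prems(4) X_def using inj_on_image_set_diff[OF inj, of "spanning P j" "{B}"] Bspan by auto
    finally have Os': "set Os' = (\<lambda>C. C \<inter> {..<j}) ` (spanning P j - {B})" .
    have srt: "sorted_wrt (\<lambda>X Y. \<forall>x\<in>X. \<forall>y\<in>Y. y < x) Os'"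
      and top: "\<forall>Y\<in>set Os'. \<forall>x\<in>X. \<forall>y\<in>Y. y < x" using Suc.prems(3) Os by simp_all
    have below': "y < j" if "Y \<in> set Os'" "y \<in> Y" for y Y
      using below that Os by auto
    show ?thesis
    proof (cases "B \<inter> {Suc j..} = {}")
      case True
      then have BX: "B = insert j X" using Bsub B(2) X_def by blast
      have "set Os' = (\<lambda>C. C \<inter> {..<Suc j}) ` spanning P (Suc j)"
        unfolding span(1) using True span(2) Os' by simp
      then obtain c where "sweep m (Suc j) Os' {B \<in> P. B \<inter> {Suc j..} \<noteq> {}} c"
        using Suc.IH[of "Suc j" Os'] Suc.prems srt by auto
      moreover have "even (card (insert j X))" using BX even B(1) by simp
      ultimately have "sweep (Suc m) j (X # Os') (insert (insert j X) {B \<in> P. B \<inter> {Suc j..} \<noteq> {}}) (False # False # c)"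
        by (rule sweep.close_block)
      then show ?thesis unfolding span(3) Os BX[symmetric] by blast
    next
      case cont: False
      have BX: "B \<inter> {..<Suc j} = insert j X" using B(2) X_def by (auto simp: less_Suc_eq)
      have "spanning P (Suc j) = insert B (spanning P j - {B})" unfolding span(1) using cont by auto
      then have "set (insert j X # Os') = (\<lambda>C. C \<inter> {..<Suc j}) ` spanning P (Suc j)"
        by (simp only: image_insert span(2) list.set Os' BX)
      moreover have "sorted_wrt (\<lambda>X Y. \<forall>x\<in>X. \<forall>y\<in>Y. y < x) (insert j X # Os')"
        using srt top below' by simp
      ultimately obtain c where "sweep m (Suc j) (insert j X # Os') {B \<in> P. B \<inter> {Suc j..} \<noteq> {}} c"
        using Suc.IH[of "Suc j" "insert j X # Os'"] Suc.prems by auto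
      then have "sweep (Suc m) j (X # Os') {B \<in> P. B \<inter> {Suc j..} \<noteq> {}} (False # True # c)"
        by (rule sweep.extend)
      moreover have "{C \<in> P. C \<inter> {j..} \<noteq> {}} = {B \<in> P. B \<inter> {Suc j..} \<noteq> {}}"
        unfolding span(3) using B(1) cont by blast
      ultimately show ?thesis unfolding Os by auto
    qed
  qed
qed

lemma sweep_nc_even_partition:
  assumes "P \<in> nc_even_partitions k"
  shows "sweep k 1 [] P (partition_code P k 1)"
proof -
  have part: "partition_on {1..k} P" using assms by (simp add: nc_even_partitions_def)
  have ge: "1 \<le> x" if "B \<in> P" "x \<in> B" for B x
    using partition_onD1[OF part] that by auto
  have "B \<inter> {1..} \<noteq> {}" if "B \<in> P" for B
  proof -
    have "B \<noteq> {}" using partition_onD3[OF part] that by blast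
    then obtain x where "x \<in> B" by blast
    then show ?thesis using ge[OF that] by blast
  qed
  then have "{B \<in> P. B \<inter> {1..} \<noteq> {}} = P" by blast
  moreover have "spanning P 1 = {}"
  proof -
    have "B \<inter> {..<1} = {}" if "B \<in> P" for B using ge[OF that] by force
    then show ?thesis by (simp add: spanning_def)
  qed
  ultimately obtain c where c: "sweep k 1 [] P c"
    using ex_sweep_from[OF part, of 1 k "[]"] assms by (auto simp: nc_even_partitions_def)
  then show ?thesis using sweep_partition_code[OF c open_stack_Nil] by simp
qed

lemma nc_even_partition_sweep:
  assumes "sweep k 1 [] P c"
  shows "P \<in> nc_even_partitions k"
proof -
  note blocks = sweep_blocks[OF assms open_stack_Nil, simplified]
  have "\<Union>P = {1..k}" using blocks(3) by auto
  then show ?thesis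
    using blocks(4-8) by (auto simp: nc_even_partitions_def partition_on_def)
qed

theorem bij_betw_partition_code:
  "bij_betw (\<lambda>P. partition_code P k 1) (nc_even_partitions k) (admissible_words [] (point_word k 1))"
proof (rule bij_betwI')
  fix P Q assume P: "P \<in> nc_even_partitions k" and Q: "Q \<in> nc_even_partitions k"
  show "(partition_code P k 1 = partition_code Q k 1) = (P = Q)"
    using sweep_unique sweep_nc_even_partition[OF P] sweep_nc_even_partition[OF Q] by metis
next
  fix P assume "P \<in> nc_even_partitions k"
  from sweep_admissible[OF sweep_nc_even_partition[OF this] open_stack_Nil]
  show "partition_code P k 1 \<in> admissible_words [] (point_word k 1)"
    by (simp add: admissible_words_def)
next
  fix c assume "c \<in> admissible_words [] (point_word k 1)"
  then obtain P where P: "sweep k 1 [] P c"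
    using admissible_sweep[of "[]" k 1 c] by (auto simp: admissible_words_def open_stack_Nil)
  show "\<exists>P\<in>nc_even_partitions k. c = partition_code P k 1"
    using nc_even_partition_sweep[OF P] sweep_partition_code[OF P open_stack_Nil] by auto
qed

section \<open>The star and the blocks of the join\<close>

text \<open>
  The star with centre \<open>None\<close> and four leaves. With weight \<open>2\<close> at the centre and \<open>1\<close> at the leaves it satisfies
  the eigenvector equation for \<open>t = 2\<close>: four leaves of weight one around the centre, the centre of weight two next to each leaf. A closed
  walk from the centre visits a leaf at every point of \<open>{1..k}\<close> and is thus a function from the points to the leaves.
\<close>

definition star_nb :: "'k \<Rightarrow> (bool \<times> bool) option \<Rightarrow> (bool \<times> bool) option set" where
  "star_nb k v = (case v of None \<Rightarrow> range Some | Some _ \<Rightarrow> {None})"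

definition star_dim :: "(bool \<times> bool) option \<Rightarrow> rat" where
  "star_dim v = (case v of None \<Rightarrow> 2 | Some _ \<Rightarrow> 1)"

lemma star_simps [simp]:
  "star_nb k None = range Some" "star_nb k (Some l) = {None}"
  "star_dim None = 2" "star_dim (Some l) = 1"
  by (simp_all add: star_nb_def star_dim_def)

lemma card_bool_pairs: "card (UNIV :: (bool \<times> bool) set) = 4"
  unfolding UNIV_Times_UNIV[symmetric] by (simp only: card_cartesian_product card_UNIV_bool)

interpretation star: loop_model star_nb star_dim 2 None
proof
  fix k :: 'k and x y :: "(bool \<times> bool) option"
  show "finite (star_nb k x)" by (cases x) simp_all
  show "star_dim x \<noteq> 0" by (cases x) simp_all
  show "x \<in> star_nb k y" if "y \<in> star_nb k x"
    using that by (cases x; cases y) auto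
  have "(\<Sum>y\<in>range Some. star_dim y) = of_nat (card (range (Some :: bool \<times> bool \<Rightarrow> _)))"
    by (simp add: sum.reindex card_image)
  then show "(\<Sum>y\<in>star_nb k x. star_dim y) = 2 * star_dim x"
    by (cases x) (simp_all add: card_image card_bool_pairs)
qed

fun star_stack :: "(bool \<times> bool) list \<Rightarrow> (bool \<times> bool) option list" where
  "star_stack [] = [None]"
| "star_stack (v # vs) = None # Some v # star_stack vs"

lemma star_stack_top [simp]: "star_stack vs \<noteq> []" "hd (star_stack vs) = None"
  by (cases vs; simp)+

fun star_path :: "(nat \<Rightarrow> bool \<times> bool) \<Rightarrow> nat \<Rightarrow> nat \<Rightarrow> (bool \<times> bool) option list" where
  "star_path x 0 j = []"
| "star_path x (Suc m) j = Some (x j) # None # star_path x m (Suc j)"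

definition constant_on :: "(nat \<Rightarrow> 'l) \<Rightarrow> nat set \<Rightarrow> bool" where
  "constant_on x B \<longleftrightarrow> (\<forall>i\<in>B. \<forall>j\<in>B. x i = x j)"

text \<open>
  The regions outside the blocks are labelled by the centre and the region of each block by a leaf, so the amplitude
  vanishes unless the function is constant on each block. Every point at which a block does not end opens a region labelled by the
  centre, of weight \<open>2\<close>.
\<close>

lemma run_star_path:
  assumes "sweep m j Os R c" "open_stack j Os" "j > 0"
    and "list_all2 (\<lambda>v X. \<forall>i\<in>X. x i = v) vs Os"
  shows "run star_dim (star_stack vs) c (star_path x m j) * 2 ^ card R =
    of_bool (\<forall>B\<in>R. constant_on x B) * 2 ^ m"
  using assms
proof (induction arbitrary: vs rule: sweep.induct)
  case (finish j)
  then show ?case by simp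
next
  case (open_block m j Os R c)
  have "run star_dim (star_stack (x j # vs)) c (star_path x m (Suc j)) * 2 ^ card R =
    of_bool (\<forall>B\<in>R. constant_on x B) * 2 ^ m"
    by (rule open_block.IH) (use open_block.prems open_stack_open in auto)
  then show ?case by simp
next
  case (extend m j X Os R c)
  then obtain v vs' where vs: "vs = v # vs'" "\<forall>i\<in>X. x i = v" "list_all2 (\<lambda>v X. \<forall>i\<in>X. x i = v) vs' Os"
    by (auto simp: list_all2_Cons2)
  note st = open_stack_extend[OF extend.prems(1)]
  show ?case
  proof (cases "x j = v")
    case True
    have "run star_dim (star_stack (v # vs')) c (star_path x m (Suc j)) * 2 ^ card R =
      of_bool (\<forall>B\<in>R. constant_on x B) * 2 ^ m"
      by (rule extend.IH[OF st]) (use vs True in auto)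
    then show ?thesis using vs True by simp
  next
    case False
    obtain B where B: "B \<in> R" "B \<inter> {..<Suc j} = insert j X"
      using sweep_blocks(2)[OF extend.hyps st, of "insert j X"] by auto
    obtain i where "i \<in> X" using extend.prems(1) unfolding open_stack_Cons by blast
    then have "i \<in> B" "j \<in> B" "x i = v" using B(2) vs(2) by blast+
    then have "\<not> constant_on x B" using False unfolding constant_on_def by metis
    then show ?thesis using B(1) vs False by auto
  qed
next
  case (close_block m j Os R c X)
  then obtain v vs' where vs: "vs = v # vs'" "\<forall>i\<in>X. x i = v" "list_all2 (\<lambda>v X. \<forall>i\<in>X. x i = v) vs' Os"
    by (auto simp: list_all2_Cons2)
  note st = open_stack_close[OF close_block.prems(1)]
  have new: "insert j X \<notin> R"
  proof
    assume "insert j X \<in> R"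
    then have "insert j X \<inter> {..<Suc j} = {} \<or> insert j X \<inter> {..<Suc j} \<in> set Os"
      by (rule sweep_blocks(1)[OF close_block.hyps(1) st zero_less_Suc])
    then have "insert j X \<inter> {..<Suc j} \<in> set Os" by auto
    moreover have "open_stack j Os" using close_block.prems(1) unfolding open_stack_Cons by blast
    ultimately have "insert j X \<inter> {..<Suc j} \<subseteq> {1..<j}" using open_stackD by blast
    then show False by auto
  qed
  have "finite R" by (rule sweep_blocks(6)[OF close_block.hyps(1) st]) simp
  then have card: "card (insert (insert j X) R) = Suc (card R)" using new by simp
  have "constant_on x (insert j X) \<longleftrightarrow> x j = v"
  proof -
    obtain i where "i \<in> X" using close_block.prems(1) unfolding open_stack_Cons by blast
    then show ?thesis using vs(2) unfolding constant_on_def by auto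
  qed
  moreover have "run star_dim (star_stack vs') c (star_path x m (Suc j)) * 2 ^ card R =
      of_bool (\<forall>B\<in>R. constant_on x B) * 2 ^ m"
    by (rule close_block.IH[OF st]) (use vs in auto)
  ultimately show ?case unfolding card using vs by (auto simp: mult_ac)
qed

lemma path_weight_star_path: "path_weight star_dim (star_path x m j) = 1 / 2 ^ m"
  by (induction m arbitrary: j) auto

lemma star_path_update: "i < j \<Longrightarrow> star_path (x(i := l)) m j = star_path x m j"
  by (induction m arbitrary: j) auto

lemma path_sum_star:
  "path_sum star_nb None (point_word m j) None f =
     (\<Sum>x\<in>{j..<j + m} \<rightarrow>\<^sub>E UNIV. f (star_path x m j) :: rat)"
proof (induction m arbitrary: j f)
  case 0
  then show ?case by simp
next
  case (Suc m)
  let ?E = "{Suc j..<Suc j + m} \<rightarrow>\<^sub>E (UNIV :: (bool \<times> bool) set)"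
  have "path_sum star_nb None (point_word (Suc m) j) None f =
    (\<Sum>l\<in>UNIV. \<Sum>x\<in>?E. f (Some l # None # star_path x m (Suc j)))"
    by (simp add: sum.reindex Suc.IH)
  also have "\<dots> = (\<Sum>(l, x)\<in>UNIV \<times> ?E. f (star_path (x(j := l)) (Suc m) j))"
    by (simp add: sum.cartesian_product star_path_update)
  also have "\<dots> = (\<Sum>x\<in>(\<lambda>(l, x). x(j := l)) ` (UNIV \<times> ?E). f (star_path x (Suc m) j))"
  proof -
    have "inj_on (\<lambda>(l, x). x(j := l)) (UNIV \<times> ?E)"
      by (rule inj_combinator) simp
    then show ?thesis by (subst sum.reindex) (simp_all add: case_prod_unfold)
  qed
  also have "(\<lambda>(l, x). x(j := l)) ` (UNIV \<times> ?E) = {j..<j + Suc m} \<rightarrow>\<^sub>E UNIV"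
  proof -
    have "{j..<j + Suc m} = insert j {Suc j..<Suc j + m}" by auto
    then show ?thesis by (simp only: PiE_insert_eq)
  qed
  finally show ?case .
qed

lemma card_constant_on_blocks:
  assumes R: "partition_on A R" and "finite A"
  shows "card {x \<in> A \<rightarrow>\<^sub>E (UNIV :: 'l::finite set). \<forall>B\<in>R. \<forall>i\<in>B. \<forall>j\<in>B. x i = x j} = card (UNIV :: 'l set) ^ card R"
proof -
  define blk where "blk i = (THE B. B \<in> R \<and> i \<in> B)" for i
  have blk: "blk i = B" if "B \<in> R" "i \<in> B" for i B
    unfolding blk_def using that partition_onD2[OF R] by (intro the_equality) (auto dest: disjointD)
  have ex: "\<exists>B\<in>R. i \<in> B" if "i \<in> A" for i
    using that partition_onD1[OF R] by blast
  have sub: "B \<subseteq> A" if "B \<in> R" for B using that partition_onD1[OF R] by blast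
  have some: "(SOME i. i \<in> B) \<in> B" if "B \<in> R" for B
    using that partition_onD3[OF R] by (metis some_in_eq)
  define C where "C = {x \<in> A \<rightarrow>\<^sub>E (UNIV :: 'l set). \<forall>B\<in>R. \<forall>i\<in>B. \<forall>j\<in>B. x i = x j}"
  define f where "f g = (\<lambda>i\<in>A. g (blk i))" for g :: "'a set \<Rightarrow> 'l"
  define h where "h x = (\<lambda>B\<in>R. x (SOME i. i \<in> B))" for x :: "'a \<Rightarrow> 'l"
  have hf: "h (f g) = g" if "g \<in> R \<rightarrow>\<^sub>E UNIV" for g
  proof
    fix B
    show "h (f g) B = g B"
    proof (cases "B \<in> R")
      case True
      then have "(SOME i. i \<in> B) \<in> A" using some sub by blast
      then show ?thesis using True blk[OF True some[OF True]] by (simp add: h_def f_def)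
    next
      case False
      then show ?thesis using PiE_arb[OF that False] by (simp add: h_def)
    qed
  qed
  have fh: "f (h x) = x" if "x \<in> C" for x
  proof
    fix i
    show "f (h x) i = x i"
    proof (cases "i \<in> A")
      case True
      then obtain B where B: "B \<in> R" "i \<in> B" using ex by blast
      then have "x (SOME i. i \<in> B) = x i" using that some[OF B(1)] unfolding C_def by blast
      then show ?thesis using True blk[OF B] B by (simp add: h_def f_def)
    next
      case False
      have "x \<in> A \<rightarrow>\<^sub>E UNIV" using that by (simp add: C_def)
      from PiE_arb[OF this False] show ?thesis using False by (simp add: f_def)
    qed
  qed
  have fC: "f g \<in> C" for g
  proof -
    have "f g i = f g j" if "B \<in> R" "i \<in> B" "j \<in> B" for B i j
    proof -
      have "i \<in> A" "j \<in> A" using that sub by blast+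
      then show ?thesis using blk[OF that(1,2)] blk[OF that(1,3)] by (simp add: f_def)
    qed
    moreover have "f g \<in> A \<rightarrow>\<^sub>E UNIV" by (simp add: f_def)
    ultimately show ?thesis unfolding C_def by blast
  qed
  have "bij_betw f (R \<rightarrow>\<^sub>E UNIV) C"
  proof (rule bij_betw_byWitness[where f' = h])
    show "h ` C \<subseteq> R \<rightarrow>\<^sub>E UNIV" by (auto simp: h_def)
  qed (use hf fh fC in auto)
  then have "card C = card (R \<rightarrow>\<^sub>E (UNIV :: 'l set))"
    by (metis bij_betw_same_card)
  also have "\<dots> = card (UNIV :: 'l set) ^ card R"
    using finite_elements[OF \<open>finite A\<close> R] by (simp add: card_PiE)
  finally show ?thesis unfolding C_def .
qed

text \<open>
  The level sets of a function form a partition, and a partition is finer than it if and only if the function is constant on the blocks.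
\<close>

lemma constant_on_join:
  assumes P: "partition_on A P" and Q: "partition_on A Q"
  shows "(\<forall>B\<in>partition_join A P Q. constant_on x B) \<longleftrightarrow>
    (\<forall>B\<in>P. constant_on x B) \<and> (\<forall>B\<in>Q. constant_on x B)"
proof
  note lub = partition_join[OF P Q, unfolded is_partition_lub_def]
  assume *: "\<forall>B\<in>partition_join A P Q. constant_on x B"
  have "constant_on x B" if "refines A S (partition_join A P Q)" "B \<in> S" for B S
  proof -
    obtain C where "C \<in> partition_join A P Q" "B \<subseteq> C"
      using \<open>refines A S (partition_join A P Q)\<close> \<open>B \<in> S\<close> unfolding refines_def by blast
    then show ?thesis using * unfolding constant_on_def by blast
  qed
  then show "(\<forall>B\<in>P. constant_on x B) \<and> (\<forall>B\<in>Q. constant_on x B)" using lub by blast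
next
  note lub = partition_join[OF P Q, unfolded is_partition_lub_def]
  assume *: "(\<forall>B\<in>P. constant_on x B) \<and> (\<forall>B\<in>Q. constant_on x B)"
  define S where "S = (\<lambda>v. {i \<in> A. x i = v}) ` x ` A"
  have S: "partition_on A S"
    unfolding S_def by (rule partition_onI) (auto simp: disjnt_def)
  have "refines A T S" if T: "partition_on A T" "\<forall>B\<in>T. constant_on x B" for T
    unfolding refines_def
  proof (intro conjI ballI T(1) S)
    fix B assume "B \<in> T"
    then have "B \<noteq> {}" "B \<subseteq> A" using T(1) partition_onD3 partition_onD1 by blast+
    then obtain i where "i \<in> B" "i \<in> A" by blast
    moreover have "B \<subseteq> {j \<in> A. x j = x i}"
      using \<open>B \<in> T\<close> T(2) \<open>i \<in> B\<close> \<open>B \<subseteq> A\<close> unfolding constant_on_def by blast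
    ultimately show "\<exists>C\<in>S. B \<subseteq> C" unfolding S_def by blast
  qed
  then have join: "refines A (partition_join A P Q) S" using lub P Q * by blast
  show "\<forall>B\<in>partition_join A P Q. constant_on x B"
  proof
    fix B assume "B \<in> partition_join A P Q"
    then obtain C where "C \<in> S" "B \<subseteq> C" using join unfolding refines_def by blast
    then obtain v where "B \<subseteq> {i \<in> A. x i = v}" unfolding S_def by blast
    then have "x i = v" if "i \<in> B" for i using that by blast
    then show "constant_on x B" unfolding constant_on_def by metis
  qed
qed

text \<open>
  The state sum of the star is \<open>2 ^ l\<close> on the one hand, and on the other a power of two times the number \<open>4 ^ \<bar>P \<or> Q\<bar>\<close> of
  functions that are constant on the blocks of the join. Comparing exponents replaces a computation
  of Euler characteristics.
\<close>

theorem loop_count_partition_join: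
  assumes P: "P \<in> nc_even_partitions k" "sweep k 1 [] P c"
    and Q: "Q \<in> nc_even_partitions k" "sweep k 1 [] Q c'"
    and l: "loop_count (point_word k 1) c c' l"
  shows "l + card P + card Q = k + 2 * card (partition_join {1..k} P Q)"
proof -
  let ?J = "partition_join {1..k} P Q"
  let ?E = "{1..k} \<rightarrow>\<^sub>E (UNIV :: (bool \<times> bool) set)"
  have part: "partition_on {1..k} P" "partition_on {1..k} Q"
    using P Q by (auto simp: nc_even_partitions_def)
  then have J: "partition_on {1..k} ?J"
    using partition_join[OF part] by (auto simp: is_partition_lub_def refines_def)
  have run: "run star_dim [None] c (star_path x k 1) * 2 ^ card R = of_bool (\<forall>B\<in>R. constant_on x B) * 2 ^ k"
    if "sweep k 1 [] R c" for x R c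
    using run_star_path[OF that open_stack_Nil, of x "[]"] by simp
  have finE: "finite ?E" by (simp add: finite_PiE)
  have "(2::rat) ^ l = star.pairing (point_word k 1) [None] [None] c c'"
    using star.pairing_loop_count[OF l] by simp
  also have "\<dots> = (\<Sum>x\<in>?E. path_weight star_dim (star_path x k 1) *
      run star_dim [None] c (star_path x k 1) * run star_dim [None] c' (star_path x k 1))"
    unfolding star.pairing_def by (simp add: path_sum_star atLeastLessThanSuc_atLeastAtMost)
  finally have "(2::rat) ^ l * 2 ^ card P * 2 ^ card Q = (\<Sum>x\<in>?E. path_weight star_dim (star_path x k 1) *
      (run star_dim [None] c (star_path x k 1) * 2 ^ card P) * (run star_dim [None] c' (star_path x k 1) * 2 ^ card Q))"
    by (simp add: sum_distrib_left mult_ac)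
  also have "\<dots> = (\<Sum>x\<in>?E. of_bool (\<forall>B\<in>?J. constant_on x B) * 2 ^ k)"
    unfolding run[OF P(2)] run[OF Q(2)] path_weight_star_path constant_on_join[OF part]
    by (rule sum.cong) auto
  also have "\<dots> = of_nat (card {x \<in> ?E. \<forall>B\<in>?J. constant_on x B}) * 2 ^ k"
    using finE by (simp add: sum_distrib_right[symmetric] sum.inter_filter[symmetric] of_bool_def)
  also have "card {x \<in> ?E. \<forall>B\<in>?J. constant_on x B} = 4 ^ card ?J"
    using card_constant_on_blocks[OF J, where 'l = "bool \<times> bool"] by (simp add: constant_on_def card_bool_pairs)
  finally have "(2::rat) ^ (l + card P + card Q) = 2 ^ (k + 2 * card ?J)"
    by (simp add: power_add power_mult mult_ac)
  then show ?thesis by (simp only: power_inject_exp)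
qed

section \<open>The tree of colour stacks and the triangular factorisation\<close>

text \<open>
  The walk in the tree of colour stacks that is traced by the stack of a word itself.
\<close>

fun tree_path :: "'k list \<Rightarrow> 'k list \<Rightarrow> bool list \<Rightarrow> 'k list list" where
  "tree_path q (k # w) (True # c) = (k # q) # tree_path (k # q) w c"
| "tree_path q (k # w) (False # c) = tl q # tree_path (tl q) w c"
| "tree_path q [] c = []"
| "tree_path q w [] = []"

fun height_sum :: "nat \<Rightarrow> bool list \<Rightarrow> nat" where
  "height_sum n [] = 0"
| "height_sum n (True # c) = Suc n + height_sum (Suc n) c"
| "height_sum n (False # c) = (n - 1) + height_sum (n - 1) c"

text \<open>
  Here \<open>S\<close> is a stack of labels, each of which is a vertex of the tree: the label of a region nested in
  \<open>i\<close> others is reached from the root in at most \<open>i\<close> steps.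
\<close>

fun fits :: "'k list list \<Rightarrow> bool" where
  "fits [] = True"
| "fits (x # S) = (length x \<le> length S \<and> fits S)"

text \<open>
  Adjacent regions carry labels whose heights differ by one, so at every letter the walk \<open>e\<close> is at most as high as the number of
  arcs of \<open>c\<close> that are open. If the total heights agree, all heights agree, and the heights of a word
  determine its letters.
\<close>

lemma run_tree_path_nonzero:
  assumes "run d S c (tree_path q w e) \<noteq> 0" "S \<noteq> []" "hd S = q" "fits S" "admissible q w e"
    and "length c = length w"
  shows "height_sum (length q) e \<le> height_sum (length S - 1) c"
    and "length q = length S - 1 \<Longrightarrow> height_sum (length q) e = height_sum (length S - 1) c \<Longrightarrow> e = c"
proof -
  have "height_sum (length q) e \<le> height_sum (length S - 1) c \<and>
    (length q = length S - 1 \<and> height_sum (length q) e = height_sum (length S - 1) c \<longrightarrow> e = c)"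
    using assms
  proof (induction w arbitrary: S q e c)
    case Nil
    then show ?case using admissible_length[of q "[]" e] by simp
  next
    case (Cons k w)
    obtain e0 e' where e: "e = e0 # e'" using Cons.prems by (cases e) auto
    obtain c0 c' where c: "c = c0 # c'" "length c' = length w" using Cons.prems by (cases c) auto
    obtain S' where S: "S = q # S'" "length q \<le> length S'" "fits S'"
      using Cons.prems by (cases S) auto
    define y where "y = (if e0 then k # q else tl q)"
    have path: "tree_path q (k # w) e = y # tree_path y w e'"
      and y: "admissible y w e'" "if e0 then length y = Suc (length q) else length q = Suc (length y)"
      and he: "height_sum (length q) e = length y + height_sum (length y) e'"
      using Cons.prems e y_def by (cases e0; cases q; simp)+
    show ?case
    proof (cases c0)
      case True
      have "run d (y # S) c' (tree_path y w e') \<noteq> 0"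
        using Cons.prems(1) path c True by simp
      moreover have "fits (y # S)" using S y(2) by (auto split: if_splits)
      ultimately have "height_sum (length y) e' \<le> height_sum (length S) c' \<and>
         (length y = length S \<and> height_sum (length y) e' = height_sum (length S) c' \<longrightarrow> e' = c')"
        using Cons.IH[of "y # S" c' y e'] y(1) c(2) by auto
      moreover have "height_sum (length S - 1) c = length S + height_sum (length S) c'"
        using c True S by simp
      moreover have "length y \<le> length S" using \<open>fits (y # S)\<close> by simp
      ultimately show ?thesis using he e c True y(2) S by (auto split: if_splits)
    next
      case False
      have r: "S' \<noteq> []" "hd S' = y" "run d S' c' (tree_path y w e') \<noteq> 0"
        using Cons.prems(1) path c False S by (auto split: if_splits)
      have IH: "height_sum (length y) e' \<le> height_sum (length S' - 1) c' \<and>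
         (length y = length S' - 1 \<and> height_sum (length y) e' = height_sum (length S' - 1) c' \<longrightarrow> e' = c')"
        using Cons.IH[of S' c' y e'] r S(3) y(1) c(2) by auto
      moreover have "height_sum (length S - 1) c = length S' - 1 + height_sum (length S' - 1) c'"
        using c False S by simp
      moreover have "length y \<le> length S' - 1" using S r by (cases S') auto
      ultimately show ?thesis using he e c False y(2) S r by (auto split: if_splits)
    qed
  qed
  then show "height_sum (length q) e \<le> height_sum (length S - 1) c"
    and "length q = length S - 1 \<Longrightarrow> height_sum (length q) e = height_sum (length S - 1) c \<Longrightarrow> e = c"
    by auto
qed

fun tails :: "'k list \<Rightarrow> 'k list list" where
  "tails [] = [[]]"
| "tails (k # q) = (k # q) # tails q"

lemma tails_not_Nil [simp]: "tails q \<noteq> []" and hd_tails [simp]: "hd (tails q) = q"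
  by (cases q; simp)+

fun rise_weight :: "('k list \<Rightarrow> 'f::field) \<Rightarrow> 'k list \<Rightarrow> 'k list \<Rightarrow> bool list \<Rightarrow> 'f" where
  "rise_weight d q (k # w) (True # c) = d (k # q) / d q * rise_weight d (k # q) w c"
| "rise_weight d q (k # w) (False # c) = rise_weight d (tl q) w c"
| "rise_weight d q [] c = 1"
| "rise_weight d q w [] = 1"

text \<open>
  For a word and its own walk the constraints in \<open>run\<close> hold. An arc contributes its factor \<open>d\<close> twice, while the weight of the walk divides
  by the labels just inside and just outside of it. The product on the left accounts for the arcs of
  \<open>q\<close>, whose closing letters occur in \<open>c\<close> but whose opening letters do not.
\<close>

lemma path_weight_run_tree_path:
  assumes d: "\<And>x. d x \<noteq> 0" and "admissible q w c"
  shows "path_weight d (tree_path q w c) * (run d (tails q) c (tree_path q w c))\<^sup>2 *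
     (\<Prod>x\<leftarrow>tl (tails q). d x) = rise_weight d q w c"
  using assms(2)
proof (induction q w c rule: admissible.induct)
  case (1 q)
  then show ?case by simp
next
  case (4 q k w c)
  have "(\<Prod>x\<leftarrow>tails q. d x) = d q * (\<Prod>x\<leftarrow>tl (tails q). d x)"
    by (cases q) auto
  with 4 have "path_weight d (tree_path (k # q) w c) * (run d (tails (k # q)) c (tree_path (k # q) w c))\<^sup>2 *
     (d q * (\<Prod>x\<leftarrow>tl (tails q). d x)) = rise_weight d (k # q) w c" by simp
  from this[symmetric] show ?case using d by (simp add: power_mult_distrib power2_eq_square field_simps)
next
  case (5 q k w c)
  then obtain q' where q: "q = k # q'" by (cases q) auto
  have "(\<Prod>x\<leftarrow>tails q'. d x) = d q' * (\<Prod>x\<leftarrow>tl (tails q'). d x)"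
    by (cases q') auto
  moreover have "path_weight d (tree_path q' w c) * (run d (tails q') c (tree_path q' w c))\<^sup>2 *
     (\<Prod>x\<leftarrow>tl (tails q'). d x) = rise_weight d q' w c" using 5 q by simp
  ultimately show ?case using d q by (simp add: field_simps)
qed auto

text \<open>
  Along a permutation with only nonzero entries the rank never increases; since the sum of all ranks is
  preserved, it never decreases either, so such a permutation is the identity.
\<close>

lemma det_triangular_by_rank:
  fixes A :: "'a::comm_ring_1 mat" and rk :: "nat \<Rightarrow> nat"
  assumes A: "A \<in> carrier_mat n n"
    and tri: "\<And>i j. i < n \<Longrightarrow> j < n \<Longrightarrow> i \<noteq> j \<Longrightarrow> rk i \<le> rk j \<Longrightarrow> A $$ (i, j) = 0"
  shows "det A = (\<Prod>i<n. A $$ (i, i))"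
proof -
  have zero: "(\<Prod>i = 0..<n. A $$ (i, p i)) = 0" if p: "p permutes {0..<n}" and "p \<noteq> id" for p
  proof (rule ccontr)
    assume nz: "(\<Prod>i = 0..<n. A $$ (i, p i)) \<noteq> 0"
    have ent: "A $$ (i, p i) \<noteq> 0" if "i < n" for i
      using nz that by (metis atLeastLessThan_iff finite_atLeastLessThan le0 prod_zero)
    have less: "p i < n" if "i < n" for i
      using permutes_in_image[OF p, of i] that by auto
    have le: "rk (p i) \<le> rk i" if "i < n" for i
      using tri[OF that less[OF that]] ent[OF that] by (metis nat_le_linear)
    have "\<exists>i. p i \<noteq> i" using \<open>p \<noteq> id\<close> by (auto simp: fun_eq_iff)
    then obtain i where i: "p i \<noteq> i" by blast
    then have "i < n" using permutes_not_in[OF p, of i] by (cases "i < n") auto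
    then have "rk (p i) < rk i"
      using tri[OF \<open>i < n\<close> less[OF \<open>i < n\<close>]] ent[OF \<open>i < n\<close>] i by (metis not_le)
    then have "(\<Sum>i = 0..<n. rk (p i)) < (\<Sum>i = 0..<n. rk i)"
      using le \<open>i < n\<close> by (intro sum_strict_mono_ex1) auto
    moreover have "(\<Sum>i = 0..<n. rk (p i)) = (\<Sum>i = 0..<n. rk i)"
      using sum.permute[OF p, of rk] by (simp add: o_def)
    ultimately show False by simp
  qed
  have "det A = (\<Sum>p | p permutes {0..<n}. signof p * (\<Prod>i = 0..<n. A $$ (i, p i)))"
    using A by (rule det_def')
  also have "\<dots> = (\<Sum>p\<in>{id}. signof p * (\<Prod>i = 0..<n. A $$ (i, p i)))"
    by (rule sum.mono_neutral_right) (auto simp: zero permutes_id finite_permutations)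
  also have "\<dots> = (\<Prod>i<n. A $$ (i, i))" by (simp add: atLeast0LessThan)
  finally show ?thesis .
qed

locale chebyshev_values =
  fixes t :: "'f::field" and P :: "nat \<Rightarrow> 'f"
  assumes P_0: "P 0 = 1" and P_1: "P (Suc 0) = t"
    and P_Suc: "P (Suc (Suc r)) = t * P (Suc r) - P r"
    and P_nonzero [simp]: "P r \<noteq> 0"
begin

definition tree_nb :: "'k \<Rightarrow> 'k list \<Rightarrow> 'k list set" where
  "tree_nb k q = insert (k # q) (if q \<noteq> [] \<and> hd q = k then {tl q} else {})"

fun tree_dim :: "'k list \<Rightarrow> 'f" where
  "tree_dim [] = 1"
| "tree_dim (k # q) = tree_dim q * (P (Suc (run_length k q)) / P (run_length k q))"

lemma tree_dim_nonzero [simp]: "tree_dim q \<noteq> 0"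
  by (induction q) auto

text \<open>
  On a run of colour \<open>k\<close> the weights are a constant times \<open>P\<^sub>0, P\<^sub>1, P\<^sub>2\<close> and so on, and the eigenvector equation is the
  recursion for the Chebyshev polynomials. For a colour different from the top of the stack only the neighbour
  above exists, and the equation reads \<open>P\<^sub>1 = t P\<^sub>0\<close>.
\<close>

sublocale tree: loop_model tree_nb tree_dim t "[]"
proof
  fix k :: 'k and x y :: "'k list"
  show "finite (tree_nb k x)" by (simp add: tree_nb_def)
  show "x \<in> tree_nb k y" if yx: "y \<in> tree_nb k x"
  proof -
    consider "y = k # x" | "x \<noteq> []" "hd x = k" "y = tl x"
      using yx by (auto simp: tree_nb_def split: if_splits)
    then show ?thesis
    proof cases
      case 1
      then show ?thesis by (simp add: tree_nb_def)
    next
      case 2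
      then have "x = k # y" by (metis list.collapse)
      then show ?thesis by (simp add: tree_nb_def)
    qed
  qed
  show "tree_dim x \<noteq> 0" by simp
  show "(\<Sum>y\<in>tree_nb k x. tree_dim y) = t * tree_dim x"
  proof (cases "x \<noteq> [] \<and> hd x = k")
    case True
    then obtain q where x: "x = k # q" by (cases x) auto
    have "tree_nb k x = {k # x, q}" using x by (simp add: tree_nb_def)
    moreover have "k # x \<noteq> q"
    proof
      assume "k # x = q"
      then have "length (k # x) = length q" by simp
      then show False using x by simp
    qed
    ultimately have "(\<Sum>y\<in>tree_nb k x. tree_dim y) = tree_dim (k # x) + tree_dim q" by simp
    also have "\<dots> = t * tree_dim x" unfolding x by (simp add: P_Suc field_simps)
    finally show ?thesis .
  next
    case False
    then have "run_length k x = 0" by (cases x) auto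
    moreover have "tree_nb k x = {k # x}" using False by (auto simp: tree_nb_def)
    ultimately show ?thesis by (simp add: P_0 P_1)
  qed
qed

lemma path_sum_tree:
  "path_sum tree_nb [] w q f = (\<Sum>c\<in>admissible_words q w. f (tree_path q w c))"
proof (induction w arbitrary: q f)
  case Nil
  then show ?case by (simp add: admissible_words_Nil)
next
  case (Cons k w)
  have "k # q \<noteq> tl q"
  proof
    assume "k # q = tl q"
    then have "length (k # q) = length (tl q)" by simp
    then show False by simp
  qed
  then have "path_sum tree_nb [] (k # w) q f = path_sum tree_nb [] w (k # q) (\<lambda>h. f ((k # q) # h)) +
    (if q \<noteq> [] \<and> hd q = k then path_sum tree_nb [] w (tl q) (\<lambda>h. f (tl q # h)) else 0)"
    by (simp add: tree_nb_def)
  then show ?case by (simp add: Cons.IH sum_admissible_words_Cons)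
qed

lemma rise_weight_tree:
  assumes "admissible q w c" "length q + length w \<le> M"
  shows "rise_weight tree_dim q w c = (\<Prod>r = 1..M. (P r / P (r - 1)) ^ rises r q w c)"
  using assms
proof (induction q w c rule: admissible.induct)
  case (4 q k w c)
  define m where "m = Suc (run_length k q)"
  have "run_length k q \<le> length q" unfolding run_length_def by (rule length_takeWhile_le)
  then have m: "m \<in> {1..M}" using 4 by (simp add: m_def)
  have "(\<Prod>r = 1..M. (P r / P (r - 1)) ^ rises r q (k # w) (True # c)) =
    (\<Prod>r = 1..M. (if r = m then P r / P (r - 1) else 1) * (P r / P (r - 1)) ^ rises r (k # q) w c)"
    by (rule prod.cong) (auto simp: m_def)
  also have "\<dots> = P m / P (m - 1) * (\<Prod>r = 1..M. (P r / P (r - 1)) ^ rises r (k # q) w c)"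
    using m by (simp add: prod.distrib prod.delta)
  also have "\<dots> = rise_weight tree_dim q (k # w) (True # c)"
    using 4 by (simp add: m_def)
  finally show ?case ..
next
  case (5 q k w c)
  then show ?case by (cases q) auto
qed auto

lemma prod_rise_weight_tree:
  assumes "length w \<le> M"
  shows "(\<Prod>c\<in>admissible_words [] w. rise_weight tree_dim [] w c) =
    (\<Prod>r = 1..M. (P r / P (r - 1)) ^ total_rises r [] w)"
proof -
  have "(\<Prod>c\<in>admissible_words [] w. rise_weight tree_dim [] w c) =
    (\<Prod>c\<in>admissible_words [] w. \<Prod>r = 1..M. (P r / P (r - 1)) ^ rises r [] w c)"
    using assms by (intro prod.cong refl rise_weight_tree) (auto simp: admissible_words_def)
  also have "\<dots> = (\<Prod>r = 1..M. \<Prod>c\<in>admissible_words [] w. (P r / P (r - 1)) ^ rises r [] w c)"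
    by (rule prod.swap)
  finally show ?thesis by (simp add: total_rises_def power_sum)
qed

lemma prod_ratio_telescope:
  "(\<Prod>r = 1..M. (P r / P (r - 1)) ^ N r) =
    (\<Prod>r = 1..M. P r powi (int (N r) - int (N (Suc r)))) * P M ^ N (Suc M)"
proof (induction M)
  case 0
  then show ?case by (simp add: P_0)
next
  case (Suc M)
  have merge: "P (Suc M) powi (int (N (Suc M)) - int (N (Suc (Suc M)))) * P (Suc M) ^ N (Suc (Suc M)) =
    P (Suc M) ^ N (Suc M)"
    by (simp add: power_int_diff)
  have "(\<Prod>r = 1..Suc M. (P r / P (r - 1)) ^ N r) =
    (\<Prod>r = 1..M. (P r / P (r - 1)) ^ N r) * (P (Suc M) / P M) ^ N (Suc M)" by simp
  also have "\<dots> = (\<Prod>r = 1..M. P r powi (int (N r) - int (N (Suc r)))) * (P M ^ N (Suc M) * (P (Suc M) / P M) ^ N (Suc M))"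
    by (simp only: Suc mult.assoc)
  also have "P M ^ N (Suc M) * (P (Suc M) / P M) ^ N (Suc M) = P (Suc M) ^ N (Suc M)"
    by (simp add: power_divide)
  finally show ?case by (simp add: merge mult.assoc)
qed

text \<open>
  The state sum over the tree is a sum over words, so the matrix is a product \<open>V D V\<^sup>T\<close>; \<open>V\<close> is triangular when the words are
  ranked by their total height.
\<close>

lemma det_pairing_tree:
  fixes w :: "'k list" and cs :: "bool list list" and a :: "nat \<Rightarrow> 'f" and e :: 'f
  assumes cs: "distinct cs" "set cs = admissible_words [] w"
  defines "n \<equiv> length cs"
  shows "det (mat n n (\<lambda>(i, j). a i * a j * e * tree.pairing w [[]] [[]] (cs ! i) (cs ! j))) =
    (\<Prod>i<n. (a i)\<^sup>2 * e * rise_weight tree_dim [] w (cs ! i))"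
proof -
  define h where "h i = tree_path [] w (cs ! i)" for i
  define V where "V i j = a i * run tree_dim [[]] (cs ! i) (h j)" for i j
  define A where "A = mat n n (\<lambda>(i, j). V i j)"
  define A' where "A' = mat n n (\<lambda>(i, j). e * path_weight tree_dim (h i) * V j i)"
  \<comment> \<open>\<open>A\<close> is the triangular factor \<open>V\<close>, and \<open>A'\<close> is \<open>D V\<^sup>T\<close>\<close>
  have adm: "admissible [] w (cs ! i)" if "i < n" for i
    using that cs nth_mem[of i cs] by (auto simp: n_def admissible_words_def)
  have tri: "V i j = 0" if "i < n" "j < n" "i \<noteq> j" "height_sum 0 (cs ! i) \<le> height_sum 0 (cs ! j)" for i j
  proof (rule ccontr)
    assume "V i j \<noteq> 0"
    then have nz: "run tree_dim [[]] (cs ! i) (tree_path [] w (cs ! j)) \<noteq> 0" by (auto simp: V_def h_def)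
    note tri = run_tree_path_nonzero[OF nz _ _ _ adm[OF \<open>j < n\<close>] admissible_length[OF adm[OF \<open>i < n\<close>]]]
    have "cs ! j = cs ! i" using tri(1) tri(2) that by simp
    then show False using that cs by (simp add: n_def nth_eq_iff_index_eq)
  qed
  have "det A = (\<Prod>i<n. A $$ (i, i))"
    by (rule det_triangular_by_rank[where rk = "\<lambda>i. height_sum 0 (cs ! i)"]) (auto simp: A_def tri)
  then have detA: "det A = (\<Prod>i<n. V i i)" by (simp add: A_def)
  have A': "A' \<in> carrier_mat n n" by (simp add: A'_def)
  have "det (transpose_mat A') = (\<Prod>i<n. transpose_mat A' $$ (i, i))"
    by (rule det_triangular_by_rank[where rk = "\<lambda>i. height_sum 0 (cs ! i)"]) (auto simp: A'_def tri)
  then have detA': "det A' = (\<Prod>i<n. e * path_weight tree_dim (h i) * V i i)"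
    unfolding det_transpose[OF A'] by (simp add: A'_def)
  have "mat n n (\<lambda>(i, j). a i * a j * e * tree.pairing w [[]] [[]] (cs ! i) (cs ! j)) = A * A'"
  proof (rule eq_matI)
    fix i j assume "i < dim_row (A * A')" "j < dim_col (A * A')"
    then have ij: "i < n" "j < n" by (auto simp: A_def A'_def)
    have "(A * A') $$ (i, j) = (\<Sum>l = 0..<n. V i l * (e * path_weight tree_dim (h l) * V j l))"
      using ij by (simp add: A_def A'_def scalar_prod_def)
    also have "\<dots> = (\<Sum>l<n. a i * a j * e * (path_weight tree_dim (tree_path [] w (cs ! l)) *
        run tree_dim [[]] (cs ! i) (tree_path [] w (cs ! l)) * run tree_dim [[]] (cs ! j) (tree_path [] w (cs ! l))))"
      by (rule sum.cong) (auto simp: V_def h_def mult_ac)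
    also have "\<dots> = (\<Sum>c\<in>set cs. a i * a j * e * (path_weight tree_dim (tree_path [] w c) *
        run tree_dim [[]] (cs ! i) (tree_path [] w c) * run tree_dim [[]] (cs ! j) (tree_path [] w c)))"
      by (rule sum.reindex_bij_betw) (use cs in \<open>auto simp: n_def intro!: bij_betw_nth\<close>)
    also have "\<dots> = a i * a j * e * tree.pairing w [[]] [[]] (cs ! i) (cs ! j)"
      unfolding tree.pairing_def path_sum_tree cs by (simp add: sum_distrib_left)
    finally show "mat n n (\<lambda>(i, j). a i * a j * e * tree.pairing w [[]] [[]] (cs ! i) (cs ! j)) $$ (i, j) =
      (A * A') $$ (i, j)" using ij by simp
  qed (auto simp: A_def A'_def)
  then have "det (mat n n (\<lambda>(i, j). a i * a j * e * tree.pairing w [[]] [[]] (cs ! i) (cs ! j))) = det A * det A'"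
    using det_mult[of A n A'] by (simp add: A_def A')
  also have "\<dots> = (\<Prod>i<n. V i i * (e * path_weight tree_dim (h i) * V i i))"
    unfolding detA detA' by (simp add: prod.distrib)
  also have "\<dots> = (\<Prod>i<n. (a i)\<^sup>2 * e * rise_weight tree_dim [] w (cs ! i))"
  proof (rule prod.cong[OF refl])
    fix i assume "i \<in> {..<n}"
    then have "path_weight tree_dim (h i) * (run tree_dim [[]] (cs ! i) (h i))\<^sup>2 = rise_weight tree_dim [] w (cs ! i)"
      using path_weight_run_tree_path[of tree_dim "[]" w "cs ! i"] adm by (simp add: h_def)
    then have eq: "(a i)\<^sup>2 * e * rise_weight tree_dim [] w (cs ! i) =
        (a i)\<^sup>2 * e * (path_weight tree_dim (h i) * (run tree_dim [[]] (cs ! i) (h i))\<^sup>2)" by simp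
    show "V i i * (e * path_weight tree_dim (h i) * V i i) = (a i)\<^sup>2 * e * rise_weight tree_dim [] w (cs ! i)"
      unfolding eq by (simp add: V_def power2_eq_square mult_ac)
  qed
  finally show ?thesis .
qed

end

section \<open>Counting arcs by run length\<close>

text \<open>
  The inverse \<open>S\<close> of \<open>z / (1 + z)\<^sup>3\<close> with respect to composition satisfies \<open>S = z (1 + S)\<^sup>3\<close>; then \<open>z\<close> is replaced by \<open>z\<^sup>4\<close>, because the
  colours repeat after four letters.
\<close>

lemma ex_cubic_fps: "\<exists>T :: rat fps. fps_nth T 0 = 0 \<and> T = fps_X ^ 4 * (1 + T) ^ 3"
proof -
  define a :: "rat fps" where "a = fps_X * inverse ((1 + fps_X) ^ 3)"
  define S where "S = fps_inv a"
  have a0: "fps_nth a 0 = 0" by (simp add: a_def)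
  have a1: "fps_nth a 1 \<noteq> 0" by (simp add: a_def fps_mult_nth_1)
  have S0: "fps_nth S 0 = 0" by (simp add: S_def fps_inv_def)
  have "a oo S = fps_X" unfolding S_def by (rule fps_inv_right[OF a0 a1])
  then have "S * inverse ((1 + S) ^ 3) = fps_X"
    using S0 by (simp add: a_def fps_compose_mult_distrib fps_inverse_compose fps_compose_power[symmetric]
      fps_compose_add_distrib)
  moreover have "inverse ((1 + S) ^ 3) * (1 + S) ^ 3 = 1"
    by (rule inverse_mult_eq_1) (simp add: S0)
  ultimately have S: "S = fps_X * (1 + S) ^ 3" by (metis mult.assoc mult.right_neutral)
  define T where "T = S oo fps_X ^ 4"
  have "T = fps_X ^ 4 * (1 + T) ^ 3"
    unfolding T_def by (subst S) (simp add: fps_compose_mult_distrib fps_compose_power[symmetric]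
      fps_compose_add_distrib)
  moreover have "fps_nth T 0 = 0" by (simp add: T_def S0)
  ultimately show ?thesis by blast
qed

text \<open>
  This is what makes the formula for the coefficients of \<open>B ^ p\<close> give zero, beyond the constant term, at \<open>p = 0\<close>.
\<close>

lemma central_binomial: "(3 * s + 2) choose Suc s = 2 * ((3 * s + 2) choose s)"
proof -
  have "Suc s * ((3 * s + 2) choose Suc s) = (3 * s + 2 - s) * ((3 * s + 2) choose s)"
    by (simp only: binomial_absorption binomial_absorb_comp)
  also have "3 * s + 2 - s = Suc s * 2" by simp
  finally have "Suc s * ((3 * s + 2) choose Suc s) = Suc s * (2 * ((3 * s + 2) choose s))"
    by (simp only: mult.assoc)
  then show ?thesis by (metis Suc_mult_cancel1)
qed

text \<open>
  The coefficient of \<open>z ^ (4 s)\<close> in the power \<open>p + 1\<close> of \<open>B\<close>, see \<open>B_power_coeff\<close>.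
\<close>

definition ballot :: "nat \<Rightarrow> nat \<Rightarrow> rat" where
  "ballot p s = of_nat ((3 * s + p) choose s) - (if s = 0 then 0 else 2 * of_nat ((3 * s + p) choose (s - 1)))"

text \<open>
  The periodic sequence \<open>a b b a a b b a\<close> read from an even or an odd position on. It is determined by the parity of the
  position and the next letter \<open>l\<close>: after an even position the colour changes, after an odd position it
  is repeated.
\<close>

fun even_word :: "bool \<Rightarrow> nat \<Rightarrow> bool list" and odd_word :: "bool \<Rightarrow> nat \<Rightarrow> bool list" where
  "even_word l 0 = []"
| "even_word l (Suc m) = l # odd_word (\<not> l) m"
| "odd_word l 0 = []"
| "odd_word l (Suc m) = l # even_word l m"

lemma length_even_word: "length (even_word l m) = m" "length (odd_word l m) = m"
  by (induction m arbitrary: l) auto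

lemma point_word_even_word: "point_word m j = even_word (odd j) (2 * m)"
  by (induction m arbitrary: j) auto

text \<open>
  The stacks from which the root can be reached at a position of the given parity with next letter \<open>l\<close>. At even positions the
  letter closing the innermost arc is always the next one.
\<close>

fun even_stack :: "bool \<Rightarrow> bool list \<Rightarrow> bool" and odd_stack :: "bool list \<Rightarrow> bool" where
  "even_stack l [] = l"
| "even_stack l (c # q) = (c = l \<and> odd_stack q)"
| "odd_stack [] = False"
| "odd_stack (c # q) = even_stack c q"

definition top_run :: "'k list \<Rightarrow> nat" where
  "top_run q = (case q of [] \<Rightarrow> 0 | c # _ \<Rightarrow> run_length c q)"

lemma top_run_simps [simp]:
  "top_run [] = 0" "top_run [c] = 1" "top_run (c # c # q) = Suc (top_run (c # q))"
  "c \<noteq> c' \<Longrightarrow> top_run (c # c' # q) = 1"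
  by (simp_all add: top_run_def)

context
  fixes T B :: "rat fps"
  assumes T: "T = fps_X ^ 4 * B ^ 3" and B: "B = 1 + T" and T0: "fps_nth T 0 = 0"
begin

text \<open>
  Generating functions, in the number of remaining letters, for the completions of a stack. A completion fills the
  region inside every open arc and the outer region, so there is one factor for each region besides the
  factors \<open>z\<close> for the closing letters. Regions entered at even positions hold any number of arcs and contribute \<open>B\<close>.
  In those entered at odd positions the colours of the arcs alternate, and the parity of the number of further arcs is prescribed:
  even, with factor \<open>B\<close>, if the next letter could close the region, and odd, with factor \<open>z\<^sup>2 B\<^sup>2\<close>, otherwise.
\<close>

fun even_gf :: "bool list \<Rightarrow> rat fps" and odd_gf :: "bool \<Rightarrow> bool list \<Rightarrow> rat fps" where
  "even_gf [] = B"
| "even_gf (c # q) = B * fps_X * odd_gf (\<not> c) q"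
| "odd_gf l [] = 0"
| "odd_gf l (c # q) = (if l = c then B else fps_X\<^sup>2 * B\<^sup>2) * fps_X * even_gf q"

lemma even_gf_step:
  assumes "even_stack l q"
  shows "even_gf q = (if q = [] then 1 else 0) + fps_X * (odd_gf (\<not> l) (l # q) +
     (if q \<noteq> [] \<and> hd q = l then odd_gf (\<not> l) (tl q) else 0))"
proof (cases q)
  case Nil
  have *: "B = 1 + fps_X * (fps_X\<^sup>2 * B\<^sup>2 * fps_X * B)"
  proof -
    have "1 + fps_X * (fps_X\<^sup>2 * B\<^sup>2 * fps_X * B) = 1 + fps_X ^ 4 * B ^ 3"
      by (simp add: eval_nat_numeral mult_ac)
    then show ?thesis by (simp only: T[symmetric] B[symmetric])
  qed
  show ?thesis using Nil by (simp flip: *)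
next
  case (Cons c q')
  then have "c = l" using assms by simp
  have *: "B * fps_X * g = fps_X * (fps_X\<^sup>2 * B\<^sup>2 * fps_X * (B * fps_X * g) + g)" for g
  proof -
    have "fps_X * (fps_X\<^sup>2 * B\<^sup>2 * fps_X * (B * fps_X * g) + g) = (1 + fps_X ^ 4 * B ^ 3) * fps_X * g"
      by (simp add: eval_nat_numeral algebra_simps)
    then show ?thesis by (simp only: T[symmetric] B[symmetric])
  qed
  show ?thesis using Cons \<open>c = l\<close> by (simp flip: *)
qed

lemma odd_gf_step:
  assumes "odd_stack q"
  shows "odd_gf l q = fps_X * (even_gf (l # q) + (if q \<noteq> [] \<and> hd q = l then even_gf (tl q) else 0))"
proof -
  obtain c q' where q: "q = c # q'" using assms by (cases q) auto
  show ?thesis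
  proof (cases "l = c")
    case True
    have *: "B * fps_X * g = fps_X * (B * fps_X * (fps_X\<^sup>2 * B\<^sup>2 * fps_X * g) + g)" for g
    proof -
      have "fps_X * (B * fps_X * (fps_X\<^sup>2 * B\<^sup>2 * fps_X * g) + g) = (1 + fps_X ^ 4 * B ^ 3) * fps_X * g"
        by (simp add: eval_nat_numeral algebra_simps)
      then show ?thesis by (simp only: T[symmetric] B[symmetric])
    qed
    show ?thesis using q True by (simp flip: *)
  next
    case False
    have *: "fps_X\<^sup>2 * B\<^sup>2 * fps_X * g = fps_X * (B * fps_X * (B * fps_X * g))" for g
      by (simp add: eval_nat_numeral algebra_simps)
    show ?thesis using q False by (simp flip: *)
  qed
qed

text \<open>
  Both sides obey the same recursion in the number of letters.
\<close>

lemma card_admissible_words_gf: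
  "even_stack l q \<Longrightarrow> of_nat (card (admissible_words q (even_word l m))) = fps_nth (even_gf q) m"
  "odd_stack q \<Longrightarrow> of_nat (card (admissible_words q (odd_word l m))) = fps_nth (odd_gf l q) m"
proof (induction m arbitrary: l q)
  case 0
  {
    case 1
    then show ?case
      using even_gf_step[OF 1] by (auto simp: admissible_words_Nil simp del: even_gf.simps odd_gf.simps)
  next
    case 2
    then have "q \<noteq> []" by auto
    then show ?case
      using odd_gf_step[OF 2] by (auto simp: admissible_words_Nil simp del: even_gf.simps odd_gf.simps)
  }
next
  case (Suc m)
  {
    case 1
    have "odd_stack (l # q)" and "q \<noteq> [] \<Longrightarrow> odd_stack (tl q)" using 1 by (cases q; simp)+
    then show ?case
      by (subst even_gf_step[OF 1])
        (auto simp: card_admissible_words_Cons Suc.IH simp del: even_gf.simps odd_gf.simps)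
  next
    case 2
    have "even_stack l (l # q)" and "q \<noteq> [] \<Longrightarrow> even_stack (hd q) (tl q)" using 2 by (cases q; simp)+
    then show ?case
      by (subst odd_gf_step[OF 2])
        (auto simp: card_admissible_words_Cons Suc.IH simp del: even_gf.simps odd_gf.simps)
  }
qed

context
  fixes r :: nat and D :: "rat fps"
  assumes r: "r > 0" and D: "D * (1 - 2 * T) = 1"
begin

text \<open>
  The three definitions below describe the arcs of run length \<open>r\<close> in the completions of a stack. The
  factor of a region whose enclosing run has length \<open>i\<close> is multiplied by a sum of two terms. The term \<open>excess i\<close> counts
  the arcs inside that prolong the run; each further arc of the run multiplies it by \<open>T = B - 1\<close>. The other term, which contains
  \<open>D = 1 / (1 - 2 T)\<close>, counts the arcs in runs that start inside the region.
\<close>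

definition excess :: "nat \<Rightarrow> rat fps" where
  "excess i = (if i < r then T ^ (r - i) else 0)"

lemma excess_step: "excess i = T * (excess (Suc i) + of_bool (Suc i = r))"
proof -
  consider "Suc i < r" | "Suc i = r" | "r \<le> i" by linarith
  then show ?thesis
  proof cases
    case 1
    then have "r - i = Suc (r - Suc i)" by simp
    then show ?thesis using 1 by (simp add: excess_def)
  qed (auto simp: excess_def)
qed

definition full_factor :: "nat \<Rightarrow> rat fps" where
  "full_factor i = B * (excess i + T ^ r * D)"

definition half_factor :: "nat \<Rightarrow> rat fps" where
  "half_factor i = fps_X\<^sup>2 * B\<^sup>2 * (excess i + T ^ (r - 1) * D)"

text \<open>
  By the product rule: one region is chosen for the arc that is counted, and its factor is replaced.
\<close>

fun even_rise_gf :: "bool list \<Rightarrow> rat fps" and odd_rise_gf :: "bool \<Rightarrow> bool list \<Rightarrow> rat fps" where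
  "even_rise_gf [] = full_factor 0"
| "even_rise_gf (c # q) = full_factor (top_run (c # q)) * fps_X * odd_gf (\<not> c) q +
     B * fps_X * odd_rise_gf (\<not> c) q"
| "odd_rise_gf l [] = 0"
| "odd_rise_gf l (c # q) =
     (if l = c then full_factor else half_factor) (top_run (c # q)) * fps_X * even_gf q +
     (if l = c then B else fps_X\<^sup>2 * B\<^sup>2) * fps_X * even_rise_gf q"

lemma power_r: "T ^ r = T * T ^ (r - 1)"
  using r by (cases r) auto

lemma even_rise_gf_step:
  assumes "even_stack l q"
  shows "even_rise_gf q = fps_X * (odd_rise_gf (\<not> l) (l # q) +
     of_bool (run_length l (l # q) = r) * odd_gf (\<not> l) (l # q) +
     (if q \<noteq> [] \<and> hd q = l then odd_rise_gf (\<not> l) (tl q) else 0))"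
proof -
  have half: "full_factor i = fps_X * (half_factor (Suc i) * fps_X * B
      + fps_X\<^sup>2 * B\<^sup>2 * fps_X * full_factor i + of_bool (Suc i = r) * (fps_X\<^sup>2 * B\<^sup>2 * fps_X * B))" for i
  proof -
    have "fps_X * (half_factor (Suc i) * fps_X * B + fps_X\<^sup>2 * B\<^sup>2 * fps_X * full_factor i
        + of_bool (Suc i = r) * (fps_X\<^sup>2 * B\<^sup>2 * fps_X * B)) =
      (fps_X ^ 4 * B ^ 3) * (excess (Suc i) + of_bool (Suc i = r)) +
      (fps_X ^ 4 * B ^ 3) * T ^ (r - 1) * D + (fps_X ^ 4 * B ^ 3) * (excess i + T ^ r * D)"
      unfolding full_factor_def half_factor_def by (simp add: eval_nat_numeral algebra_simps)
    also have "\<dots> = excess i + T ^ r * D + T * (excess i + T ^ r * D)"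
      unfolding T[symmetric] by (simp only: excess_step[of i, symmetric] power_r[symmetric])
    also have "\<dots> = (1 + T) * (excess i + T ^ r * D)" by (simp add: algebra_simps)
    also have "\<dots> = full_factor i" by (simp only: full_factor_def B[symmetric])
    finally show ?thesis ..
  qed
  show ?thesis
  proof (cases q)
    case Nil
    then show ?thesis using half[of 0, symmetric] by simp
  next
    case (Cons c q')
    then have c: "c = l" using assms by simp
    have step: "f * fps_X * g + B * fps_X * h = fps_X * (u * fps_X * (B * fps_X * g) + fps_X\<^sup>2 * B\<^sup>2 * fps_X *
        (f * fps_X * g + B * fps_X * h) + o' * (fps_X\<^sup>2 * B\<^sup>2 * fps_X * (B * fps_X * g)) + h)"
      if "f = fps_X * (u * fps_X * B + fps_X\<^sup>2 * B\<^sup>2 * fps_X * f + o' * (fps_X\<^sup>2 * B\<^sup>2 * fps_X * B))"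
      for f g h u o'
    proof -
      have "fps_X * (u * fps_X * (B * fps_X * g) + fps_X\<^sup>2 * B\<^sup>2 * fps_X *
          (f * fps_X * g + B * fps_X * h) + o' * (fps_X\<^sup>2 * B\<^sup>2 * fps_X * (B * fps_X * g)) + h) =
        fps_X * (u * fps_X * B + fps_X\<^sup>2 * B\<^sup>2 * fps_X * f + o' * (fps_X\<^sup>2 * B\<^sup>2 * fps_X * B)) * fps_X * g
        + (1 + fps_X ^ 4 * B ^ 3) * fps_X * h"
        by (simp add: eval_nat_numeral algebra_simps)
      also have "\<dots> = f * fps_X * g + B * fps_X * h"
        by (simp only: that[symmetric] T[symmetric] B[symmetric])
      finally show ?thesis ..
    qed
    have "run_length c (c # c # q') = Suc (top_run (c # q'))" by (simp add: top_run_def)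
    then show ?thesis
      using Cons c step[OF half[of "top_run (c # q')"], symmetric] by (simp del: run_length_simps)
  qed
qed

lemma odd_rise_gf_step:
  assumes "odd_stack q"
  shows "odd_rise_gf l q = fps_X * (even_rise_gf (l # q) +
     of_bool (run_length l (l # q) = r) * even_gf (l # q) +
     (if q \<noteq> [] \<and> hd q = l then even_rise_gf (tl q) else 0))"
proof -
  obtain c q' where q: "q = c # q'" using assms by (cases q) auto
  define i where "i = top_run (c # q')"
  show ?thesis
  proof (cases "l = c")
    case True
    have *: "full_factor i * fps_X * g + B * fps_X * h =
      fps_X * (full_factor (Suc i) * fps_X * (fps_X\<^sup>2 * B\<^sup>2 * fps_X * g) +
        B * fps_X * (half_factor i * fps_X * g + fps_X\<^sup>2 * B\<^sup>2 * fps_X * h) +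
        of_bool (Suc i = r) * (B * fps_X * (fps_X\<^sup>2 * B\<^sup>2 * fps_X * g)) + h)" for g h
    proof -
      have "fps_X * (full_factor (Suc i) * fps_X * (fps_X\<^sup>2 * B\<^sup>2 * fps_X * g) +
          B * fps_X * (half_factor i * fps_X * g + fps_X\<^sup>2 * B\<^sup>2 * fps_X * h) +
          of_bool (Suc i = r) * (B * fps_X * (fps_X\<^sup>2 * B\<^sup>2 * fps_X * g)) + h) =
        ((fps_X ^ 4 * B ^ 3) * (excess (Suc i) + of_bool (Suc i = r)) +
         (fps_X ^ 4 * B ^ 3) * T ^ (r - 1) * D + (fps_X ^ 4 * B ^ 3) * (excess i + T ^ r * D)) * fps_X * g
        + (1 + fps_X ^ 4 * B ^ 3) * fps_X * h"
        unfolding full_factor_def half_factor_def by (simp add: eval_nat_numeral algebra_simps)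
      also have "\<dots> = (excess i + T ^ r * D + T * (excess i + T ^ r * D)) * fps_X * g + (1 + T) * fps_X * h"
        unfolding T[symmetric] by (simp only: excess_step[of i, symmetric] power_r[symmetric])
      also have "\<dots> = (1 + T) * (excess i + T ^ r * D) * fps_X * g + (1 + T) * fps_X * h"
        by (simp add: algebra_simps)
      also have "\<dots> = full_factor i * fps_X * g + B * fps_X * h"
        by (simp only: full_factor_def B[symmetric])
      finally show ?thesis ..
    qed
    have "run_length c (c # c # q') = Suc i" by (simp add: i_def top_run_def)
    then show ?thesis using q True by (simp flip: * i_def del: run_length_simps)
  next
    case False
    have excess_1: "excess (Suc 0) + of_bool (Suc 0 = r) = T ^ (r - 1)"
      using r by (auto simp: excess_def)
    have *: "half_factor i * fps_X * g + fps_X\<^sup>2 * B\<^sup>2 * fps_X * h =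
      fps_X * (full_factor (Suc 0) * fps_X * (B * fps_X * g) +
        B * fps_X * (full_factor i * fps_X * g + B * fps_X * h) +
        of_bool (Suc 0 = r) * (B * fps_X * (B * fps_X * g)))" for g h
    proof -
      have D': "T ^ (r - 1) + 2 * (T ^ r * D) = T ^ (r - 1) * D"
      proof -
        have "D = 1 + 2 * T * D" using D by (simp add: algebra_simps)
        then have "T ^ (r - 1) * D = T ^ (r - 1) * (1 + 2 * T * D)" by presburger
        then show ?thesis unfolding power_r by (simp add: algebra_simps)
      qed
      have "fps_X * (full_factor (Suc 0) * fps_X * (B * fps_X * g) +
          B * fps_X * (full_factor i * fps_X * g + B * fps_X * h) +
          of_bool (Suc 0 = r) * (B * fps_X * (B * fps_X * g))) =
        fps_X\<^sup>2 * B\<^sup>2 * ((excess (Suc 0) + of_bool (Suc 0 = r)) + 2 * (T ^ r * D) + excess i) * fps_X * g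
        + fps_X\<^sup>2 * B\<^sup>2 * fps_X * h"
        unfolding full_factor_def by (simp add: eval_nat_numeral algebra_simps)
      also have "\<dots> = half_factor i * fps_X * g + fps_X\<^sup>2 * B\<^sup>2 * fps_X * h"
        unfolding excess_1 D' half_factor_def by (simp add: add_ac)
      finally show ?thesis ..
    qed
    have "c = (\<not> l)" using False by auto
    then show ?thesis
      using q *[of "even_gf q'" "even_rise_gf q'"] unfolding i_def
      by (cases "Suc 0 = r") simp_all
  qed
qed

lemma total_rises_gf:
  "even_stack l q \<Longrightarrow> of_nat (total_rises r q (even_word l m)) = fps_nth (even_rise_gf q) m"
  "odd_stack q \<Longrightarrow> of_nat (total_rises r q (odd_word l m)) = fps_nth (odd_rise_gf l q) m"
proof (induction m arbitrary: l q)
  case 0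
  {
    case 1
    then show ?case
      using even_rise_gf_step[OF 1] by (auto simp: total_rises_Nil simp del: even_rise_gf.simps odd_rise_gf.simps)
  next
    case 2
    then show ?case
      using odd_rise_gf_step[OF 2] by (auto simp: total_rises_Nil simp del: even_rise_gf.simps odd_rise_gf.simps)
  }
next
  case (Suc m)
  {
    case 1
    have "odd_stack (l # q)" and "q \<noteq> [] \<Longrightarrow> odd_stack (tl q)" using 1 by (cases q; simp)+
    then show ?case
      by (subst even_rise_gf_step[OF 1])
        (auto simp: total_rises_Cons card_admissible_words_gf Suc.IH
          simp del: even_gf.simps odd_gf.simps even_rise_gf.simps odd_rise_gf.simps)
  next
    case 2
    have "even_stack l (l # q)" and "q \<noteq> [] \<Longrightarrow> even_stack (hd q) (tl q)" using 2 by (cases q; simp)+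
    then show ?case
      by (subst odd_rise_gf_step[OF 2])
        (auto simp: total_rises_Cons card_admissible_words_gf Suc.IH
          simp del: even_gf.simps odd_gf.simps even_rise_gf.simps odd_rise_gf.simps)
  }
qed

end

lemma B_0: "fps_nth B 0 = 1"
  using B T0 by simp

lemma B_power_step: "B ^ Suc p = B ^ p + fps_X ^ 4 * B ^ (p + 3)"
proof -
  have "B ^ Suc p = (1 + T) * B ^ p" by (simp only: power_Suc B[symmetric])
  also have "\<dots> = B ^ p + (fps_X ^ 4 * B ^ 3) * B ^ p"
    unfolding T[symmetric] by (simp add: algebra_simps)
  finally show ?thesis by (simp add: power_add algebra_simps)
qed

text \<open>
  The relation between consecutive powers of \<open>B\<close> is Pascal's rule for the coefficients, and together with the
  case \<open>p = 0\<close> it determines them.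
\<close>

lemma B_power_coeff: "fps_nth (B ^ Suc p) (4 * s) = ballot p s"
proof (induction s arbitrary: p)
  case 0
  then show ?case by (simp add: ballot_def fps_power_zeroth B_0)
next
  case (Suc s)
  have step: "fps_nth (B ^ Suc p) (4 * Suc s) = fps_nth (B ^ p) (4 * Suc s) + ballot (p + 2) s" for p
  proof -
    have "fps_nth (B ^ Suc p) (4 * Suc s) = fps_nth (B ^ p) (4 * Suc s) + fps_nth (B ^ Suc (p + 2)) (4 * s)"
    proof -
      have "p + 3 = Suc (p + 2)" by simp
      then have "fps_nth (B ^ Suc p) (4 * Suc s) = fps_nth (B ^ p) (4 * Suc s) +
        (if 4 * Suc s < 4 then 0 else fps_nth (B ^ Suc (p + 2)) (4 * Suc s - 4))"
        by (simp only: B_power_step fps_add_nth fps_X_power_mult_nth)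
      then show ?thesis by simp
    qed
    then show ?thesis by (simp only: Suc.IH)
  qed
  show ?case
  proof (induction p)
    case 0
    have "ballot 2 s = ballot 0 (Suc s)"
    proof (cases s)
      case 0
      then show ?thesis by (simp add: ballot_def)
    next
      case (Suc j)
      have "(3 * s + 3) choose Suc s = ((3 * s + 2) choose s) + ((3 * s + 2) choose Suc s)"
        "(3 * s + 3) choose s = ((3 * s + 2) choose j) + ((3 * s + 2) choose s)"
        using Suc by (simp_all add: eval_nat_numeral)
      then show ?thesis
        using central_binomial[of s] Suc by (simp add: ballot_def add_ac)
    qed
    then show ?case unfolding step by (simp add: numeral_2_eq_2)
  next
    case (Suc p)
    have "ballot p (Suc s) + ballot (Suc p + 2) s = ballot (Suc p) (Suc s)"
    proof (cases s)
      case 0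
      then show ?thesis by (simp add: ballot_def algebra_simps)
    next
      case (Suc j)
      have "(3 * Suc s + Suc p) choose Suc s = ((3 * Suc s + p) choose s) + ((3 * Suc s + p) choose Suc s)"
        "(3 * Suc s + Suc p) choose s = ((3 * Suc s + p) choose j) + ((3 * Suc s + p) choose s)"
        by (simp_all only: Suc add_Suc_right binomial_Suc_Suc)
      moreover have "3 * s + (Suc p + 2) = 3 * Suc s + p" by simp
      ultimately show ?thesis unfolding ballot_def using Suc by (simp add: add.assoc)
    qed
    then show ?case unfolding step[of "Suc p"] Suc .
  qed
qed

text \<open>
  Since \<open>D = 1 + 2 T D\<close>, the coefficients satisfy a recursion with the ballot numbers as inhomogeneous term.
\<close>

lemma B_power_D_coeff:
  assumes D: "D * (1 - 2 * T) = 1"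
  shows "fps_nth (B ^ Suc p * D) (4 * s) = of_nat ((3 * s + p) choose s)"
proof (induction s arbitrary: p)
  case 0
  have "fps_nth D 0 = 1" using arg_cong[OF D, of "\<lambda>f. fps_nth f 0"] T0 by simp
  then show ?case by (simp add: fps_power_zeroth B_0)
next
  case (Suc s)
  have "B ^ Suc p * D = B ^ Suc p + 2 * (fps_X ^ 4 * (B ^ Suc (p + 3) * D))"
  proof -
    have "B ^ Suc (p + 3) = B ^ Suc p * B ^ 3" by (metis add_Suc power_add)
    then have "B ^ Suc p + 2 * (fps_X ^ 4 * (B ^ Suc (p + 3) * D)) = B ^ Suc p * (1 + 2 * (T * D))"
      unfolding T by (simp add: algebra_simps)
    moreover have "D = 1 + 2 * (T * D)" using D by (simp add: algebra_simps)
    ultimately show ?thesis by metis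
  qed
  then have "fps_nth (B ^ Suc p * D) (4 * Suc s) = ballot p (Suc s) + 2 * fps_nth (B ^ Suc (p + 3) * D) (4 * s)"
    unfolding B_power_coeff[symmetric] by (simp add: fps_X_power_mult_nth numeral_fps_const)
  also have "\<dots> = of_nat ((3 * Suc s + p) choose Suc s)"
    unfolding Suc.IH by (simp add: ballot_def add_ac)
  finally show ?case .
qed

end

text \<open>
  At the root the generating function is \<open>B (T ^ r + T ^ r D)\<close>, and \<open>T ^ r = z ^ (4 r) B ^ (3 r)\<close> shifts the index \<open>s\<close> to
  \<open>s - r\<close>.
\<close>

theorem total_rises_even_word:
  assumes "r > 0"
  shows "int (total_rises r [] (even_word True (4 * s))) =
    2 * (int (binomial_int (3 * s) (int s - int r)) - int (binomial_int (3 * s) (int s - int r - 1)))"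
proof -
  obtain T :: "rat fps" where T0: "fps_nth T 0 = 0" and T: "T = fps_X ^ 4 * (1 + T) ^ 3"
    using ex_cubic_fps by blast
  define B where "B = 1 + T"
  have TB: "T = fps_X ^ 4 * B ^ 3" using T unfolding B_def .
  define D where "D = inverse (1 - 2 * T)"
  have D: "D * (1 - 2 * T) = 1"
    unfolding D_def by (rule inverse_mult_eq_1) (simp add: T0 fps_numeral_fps_const)
  have "of_nat (total_rises r [] (even_word True (4 * s))) = fps_nth (even_rise_gf T B r D []) (4 * s)"
    by (rule total_rises_gf(1)[OF TB B_def T0 \<open>r > 0\<close> D]) simp
  also have "even_rise_gf T B r D [] = fps_X ^ (4 * r) * (B ^ Suc (3 * r) + B ^ Suc (3 * r) * D)"
  proof -
    have "T ^ r = fps_X ^ (4 * r) * B ^ (3 * r)"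
      by (subst TB) (simp add: power_mult_distrib flip: power_mult)
    then show ?thesis using \<open>r > 0\<close>
      by (simp add: even_rise_gf.simps[OF TB B_def T0 \<open>r > 0\<close> D] full_factor_def[OF TB B_def T0 \<open>r > 0\<close> D]
        excess_def[OF TB B_def T0 \<open>r > 0\<close> D] algebra_simps)
  qed
  also have "fps_nth \<dots> (4 * s) = (if s < r then 0 else
      fps_nth (B ^ Suc (3 * r)) (4 * (s - r)) + fps_nth (B ^ Suc (3 * r) * D) (4 * (s - r)))"
    by (simp add: fps_X_power_mult_nth diff_mult_distrib2)
  also have "\<dots> = (if s < r then 0 else ballot (3 * r) (s - r) + of_nat ((3 * s) choose (s - r)))"
  proof (cases "s < r")
    case False
    then have "3 * (s - r) + 3 * r = 3 * s" by simp
    then show ?thesis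
      using B_power_coeff[OF TB B_def T0] B_power_D_coeff[OF TB B_def T0 D] by simp
  qed simp
  also have "\<dots> = of_int (2 * (int (binomial_int (3 * s) (int s - int r)) -
      int (binomial_int (3 * s) (int s - int r - 1))))"
  proof -
    consider "s < r" | "s = r" | j where "s = r + Suc j" by (metis less_imp_Suc_add linorder_neqE_nat add_Suc_right)
    then show ?thesis
    proof cases
      case 3
      then have "3 * (s - r) + 3 * r = 3 * s" "nat (int s - int r) = Suc j" "nat (int s - int r - 1) = j"
        by auto
      moreover have "3 * Suc j + 3 * r = 3 * s" using 3 by simp
      then have "ballot (3 * r) (Suc j) = of_nat ((3 * s) choose Suc j) - 2 * of_nat ((3 * s) choose j)"
        unfolding ballot_def by simp
      moreover have "\<not> s < r" "s - r = Suc j" "\<not> int s - int r < 0" "\<not> int s - int r - 1 < 0"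
        using 3 by auto
      ultimately show ?thesis by (simp add: binomial_int_def)
    qed (auto simp: ballot_def binomial_int_def)
  qed
  finally show ?thesis by (metis of_int_eq_iff of_int_of_nat_eq)
qed

section \<open>The determinant\<close>

text \<open>
  The value at \<open>2\<close> is \<open>r + 1\<close>.
\<close>

lemma cheb_poly_nonzero: "cheb_poly r \<noteq> (0 :: rat poly)"
proof -
  have "poly (cheb_poly r) 2 = (of_nat (Suc r) :: rat)"
    by (induction r rule: cheb_poly.induct) (simp_all add: algebra_simps)
  then show ?thesis by (metis poly_0 of_nat_eq_0_iff nat.distinct(1))
qed

lemma poly_cheb_poly_sqrt_n: "poly (cheb_poly r) sqrt_n = to_fract (cheb_poly r)"
proof (induction r rule: cheb_poly.induct)
  case (3 r)
  have "poly (cheb_poly (Suc (Suc r))) sqrt_n = sqrt_n * poly (cheb_poly (Suc r)) sqrt_n - poly (cheb_poly r) sqrt_n"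
    by simp
  also have "\<dots> = to_fract ([:0, 1:] * cheb_poly (Suc r) - cheb_poly r)"
    by (simp only: 3 to_fract_mult to_fract_diff) (simp only: sqrt_n_def)
  finally show ?case by (simp only: cheb_poly.simps)
qed (simp_all add: sqrt_n_def)

lemma sqrt_n_nonzero: "sqrt_n \<noteq> 0"
  by (simp add: sqrt_n_def)

interpretation cheb: chebyshev_values sqrt_n "\<lambda>r. poly (cheb_poly r) sqrt_n"
proof
  show "poly (cheb_poly r) sqrt_n \<noteq> 0" for r
    by (simp add: poly_cheb_poly_sqrt_n cheb_poly_nonzero)
qed simp_all

lemma prod_powi:
  assumes "finite A" "(x::'a::field) \<noteq> 0"
  shows "(\<Prod>i\<in>A. x powi f i) = x powi (\<Sum>i\<in>A. f i)"
  using assms(1) by (induction A rule: finite_induct) (simp_all add: power_int_add assms(2))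

lemma total_rises_f_coeff:
  assumes "r > 0"
  shows "int (total_rises r [] (point_word (2 * s) 1)) = 2 * f_coeff (of_nat (2 * s) / 2) (int r)"
proof -
  have s: "(of_nat (2 * s) / 2 :: rat) = of_nat s" by simp
  have "nat \<lfloor>3 * of_nat s :: rat\<rfloor> = 3 * s"
  proof -
    have "\<lfloor>3 * of_nat s :: rat\<rfloor> = \<lfloor>of_nat (3 * s) :: rat\<rfloor>" by simp
    also have "\<dots> = int (3 * s)" by (rule floor_of_nat)
    finally show ?thesis by simp
  qed
  then have "f_coeff (of_nat (2 * s) / 2) (int r) =
      int (binomial_int (3 * s) (int s - int r)) - int (binomial_int (3 * s) (int s - int r - 1))"
    unfolding s f_coeff_def by simp
  moreover have "point_word (2 * s) 1 = even_word True (4 * s)"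
    by (simp add: point_word_even_word)
  ultimately show ?thesis using total_rises_even_word[OF assms, of s] by simp
qed

lemma f_coeff_0: "f_coeff (of_nat (2 * s) / 2) r = 0" if "r > int s"
  using that by (simp add: f_coeff_def binomial_int_def)

lemma nc_even_partitions_odd: "odd k \<Longrightarrow> nc_even_partitions k = {}"
proof (rule ccontr)
  assume "odd k" "nc_even_partitions k \<noteq> {}"
  then obtain P where P: "partition_on {1..k} P" "\<forall>B\<in>P. even (card B)"
    by (auto simp: nc_even_partitions_def)
  have "card {1..k} = (\<Sum>B\<in>P. card B)"
    using P by (metis finite_atLeastAtMost product_partition finite_elements finite_subset partition_onD1 Sup_upper)
  then show False using P(2) \<open>odd k\<close> by (simp add: dvd_sum)
qed

lemma f_coeff_odd: "odd k \<Longrightarrow> f_coeff (of_nat k / 2) r = 0"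
proof -
  assume "odd k"
  have "(of_nat k / 2 :: rat) \<notin> \<int>"
  proof
    assume "(of_nat k / 2 :: rat) \<in> \<int>"
    then obtain z where "(of_nat k / 2 :: rat) = of_int z" by (auto elim: Ints_cases)
    then have "(of_int (int k) :: rat) = of_int (2 * z)" by simp
    then have "int k = 2 * z" by (simp only: of_int_eq_iff)
    then show False using \<open>odd k\<close> by (metis dvd_triv_left even_of_nat)
  qed
  then show ?thesis by (simp add: f_coeff_def)
qed

text \<open>
  By \<open>loop_count_partition_join\<close> the Gram matrix arises from the matrix of the \<open>t ^ l\<close> by multiplying the row and the column of \<open>P\<close> by
  \<open>t ^ card P\<close> and all entries by \<open>1 / t ^ k\<close>; the exponents add up to \<open>a_exp k\<close>.
\<close>

theorem det_gram_matrix_rise_weight: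
  assumes ps: "distinct ps" "set ps = nc_even_partitions k"
  shows "det (gram_matrix k (sqrt_n ^ 2) ps) = sqrt_n powi a_exp k *
    (\<Prod>c\<in>admissible_words [] (point_word k 1). rise_weight cheb.tree_dim [] (point_word k 1) c)"
proof -
  define w where "w = point_word k 1"
  define code where "code P = partition_code P k 1" for P
  define cs where "cs = map code ps"
  define n where "n = length cs"
  have bij: "bij_betw code (nc_even_partitions k) (admissible_words [] w)"
    unfolding code_def w_def by (rule bij_betw_partition_code)
  have cs: "distinct cs" "set cs = admissible_words [] w"
    using ps bij by (auto simp: cs_def distinct_map bij_betw_def)
  have Good: "ps ! i \<in> nc_even_partitions k" if "i < n" for i
    using that ps(2) nth_mem[of i ps] by (simp add: n_def cs_def)
  have entry: "(sqrt_n\<^sup>2) ^ card (partition_join {1..k} (ps ! i) (ps ! j)) =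
    sqrt_n ^ card (ps ! i) * sqrt_n ^ card (ps ! j) * (1 / sqrt_n ^ k) * cheb.tree.pairing w [[]] [[]] (cs ! i) (cs ! j)"
    if ij: "i < n" "j < n" for i j
  proof -
    have ci: "cs ! i = code (ps ! i)" "cs ! j = code (ps ! j)" using ij by (auto simp: cs_def n_def)
    have "admissible [] w (cs ! i)" "admissible [] w (cs ! j)"
      using cs(2) ij nth_mem[of _ cs] by (auto simp: n_def admissible_words_def)
    then obtain l where l: "loop_count w (cs ! i) (cs ! j) l" using loop_count_exists by blast
    have "l + card (ps ! i) + card (ps ! j) = k + 2 * card (partition_join {1..k} (ps ! i) (ps ! j))"
      using loop_count_partition_join[OF Good[OF ij(1)] sweep_nc_even_partition[OF Good[OF ij(1)]]
          Good[OF ij(2)] sweep_nc_even_partition[OF Good[OF ij(2)]]] l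
      unfolding ci code_def w_def by blast
    then have "sqrt_n ^ (card (ps ! i) + card (ps ! j) + l) =
        sqrt_n ^ k * (sqrt_n\<^sup>2) ^ card (partition_join {1..k} (ps ! i) (ps ! j))"
      by (simp add: add_ac flip: power_mult power_add)
    moreover have "cheb.tree.pairing w [[]] [[]] (cs ! i) (cs ! j) = sqrt_n ^ l"
      by (rule cheb.tree.pairing_loop_count[OF l])
    ultimately show ?thesis using sqrt_n_nonzero by (simp add: power_add field_simps)
  qed
  have "gram_matrix k (sqrt_n ^ 2) ps = mat n n (\<lambda>(i, j). sqrt_n ^ card (ps ! i) * sqrt_n ^ card (ps ! j) *
      (1 / sqrt_n ^ k) * cheb.tree.pairing w [[]] [[]] (cs ! i) (cs ! j))"
    by (rule eq_matI) (use entry in \<open>auto simp: gram_matrix_def n_def cs_def\<close>)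
  then have "det (gram_matrix k (sqrt_n ^ 2) ps) =
      (\<Prod>i<n. (sqrt_n ^ card (ps ! i))\<^sup>2 * (1 / sqrt_n ^ k) * rise_weight cheb.tree_dim [] w (cs ! i))"
    using cheb.det_pairing_tree[OF cs, of "\<lambda>i. sqrt_n ^ card (ps ! i)" "1 / sqrt_n ^ k"]
    unfolding n_def by (simp only:)
  also have "\<dots> = (\<Prod>i<n. sqrt_n powi (2 * int (card (ps ! i)) - int k)) *
      (\<Prod>i<n. rise_weight cheb.tree_dim [] w (cs ! i))"
    unfolding prod.distrib[symmetric]
  proof (rule prod.cong[OF refl])
    fix i
    have "sqrt_n powi (2 * int (card (ps ! i)) - int k) = sqrt_n powi int (card (ps ! i) * 2) / sqrt_n powi int k"
      using sqrt_n_nonzero by (simp add: power_int_diff mult.commute)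
    also have "\<dots> = (sqrt_n ^ card (ps ! i))\<^sup>2 * (1 / sqrt_n ^ k)"
      unfolding power_int_of_nat by (simp add: power_mult)
    finally show "(sqrt_n ^ card (ps ! i))\<^sup>2 * (1 / sqrt_n ^ k) * rise_weight cheb.tree_dim [] w (cs ! i) =
      sqrt_n powi (2 * int (card (ps ! i)) - int k) * rise_weight cheb.tree_dim [] w (cs ! i)" by simp
  qed
  also have "(\<Prod>i<n. sqrt_n powi (2 * int (card (ps ! i)) - int k)) =
      (\<Prod>P\<in>set ps. sqrt_n powi (2 * int (card P) - int k))"
    by (rule prod.reindex_bij_betw) (use ps in \<open>auto simp: n_def cs_def intro!: bij_betw_nth\<close>)
  also have "\<dots> = sqrt_n powi a_exp k"
    unfolding a_exp_def ps(2) by (rule prod_powi[OF finite_nc_even_partitions sqrt_n_nonzero])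
  also have "(\<Prod>i<n. rise_weight cheb.tree_dim [] w (cs ! i)) = (\<Prod>c\<in>set cs. rise_weight cheb.tree_dim [] w c)"
    by (rule prod.reindex_bij_betw) (use cs in \<open>auto simp: n_def intro!: bij_betw_nth\<close>)
  finally show ?thesis unfolding cs(2) w_def .
qed

theorem theorem5p4:
  fixes k :: nat and ps :: "nat set set list"
  assumes "distinct ps" and "set ps = nc_even_partitions k"
  shows "det (gram_matrix k (sqrt_n ^ 2) ps) =
           sqrt_n powi a_exp k *
           (\<Prod>r = 1..k div 2.
              poly (cheb_poly r) sqrt_n powi (2 * d_coeff (of_nat k / 2) (int r)))"
proof -
  let ?w = "point_word k 1" and ?P = "\<lambda>r. poly (cheb_poly r) sqrt_n"
  let ?N = "\<lambda>r. total_rises r [] ?w" and ?M = "2 * k"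
  have "(\<Prod>c\<in>admissible_words [] ?w. rise_weight cheb.tree_dim [] ?w c) =
    (\<Prod>r = 1..k div 2. ?P r powi (2 * d_coeff (of_nat k / 2) (int r)))"
  proof (cases "even k")
    case True
    then obtain s where k: "k = 2 * s" by blast
    have N: "int (?N r) = 2 * f_coeff (of_nat k / 2) (int r)" if "r > 0" for r
      using total_rises_f_coeff[OF that] unfolding k .
    have exponent: "int (?N r) - int (?N (Suc r)) = 2 * d_coeff (of_nat k / 2) (int r)" if "r > 0" for r
      unfolding N[OF that] N[OF zero_less_Suc] d_coeff_def by (simp add: add.commute)
    have "length ?w \<le> ?M" by (simp add: point_word_even_word length_even_word)
    then have "(\<Prod>c\<in>admissible_words [] ?w. rise_weight cheb.tree_dim [] ?w c) =
      (\<Prod>r = 1..?M. (?P r / ?P (r - 1)) ^ ?N r)"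
      by (rule cheb.prod_rise_weight_tree)
    also have "\<dots> = (\<Prod>r = 1..?M. ?P r powi (int (?N r) - int (?N (Suc r)))) * ?P ?M ^ ?N (Suc ?M)"
      by (rule cheb.prod_ratio_telescope)
    also have "?N (Suc ?M) = 0"
    proof -
      have "int (?N (Suc ?M)) = 2 * f_coeff (of_nat k / 2) (int (Suc ?M))" by (rule N) simp
      also have "\<dots> = 0" unfolding k by (subst f_coeff_0) auto
      finally have "int (?N (Suc ?M)) = 0" .
      then show ?thesis by simp
    qed
    also have "(\<Prod>r = 1..?M. ?P r powi (int (?N r) - int (?N (Suc r)))) =
      (\<Prod>r = 1..?M. ?P r powi (2 * d_coeff (of_nat k / 2) (int r)))"
    proof (rule prod.cong[OF refl])
      fix r assume "r \<in> {1..?M}"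
      then have "r > 0" by simp
      show "?P r powi (int (?N r) - int (?N (Suc r))) = ?P r powi (2 * d_coeff (of_nat k / 2) (int r))"
        unfolding exponent[OF \<open>r > 0\<close>] ..
    qed
    also have "\<dots> = (\<Prod>r = 1..k div 2. ?P r powi (2 * d_coeff (of_nat k / 2) (int r)))"
    proof (rule prod.mono_neutral_right)
      show "\<forall>r\<in>{1..?M} - {1..k div 2}. ?P r powi (2 * d_coeff (of_nat k / 2) (int r)) = 1"
      proof
        fix r assume "r \<in> {1..?M} - {1..k div 2}"
        then have "int s < int r" using k by auto
        then have "d_coeff (of_nat k / 2) (int r) = 0" unfolding d_coeff_def k by (simp only: f_coeff_0)
        then show "?P r powi (2 * d_coeff (of_nat k / 2) (int r)) = 1" by simp
      qed
    qed auto
    finally show ?thesis by simp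
  next
    case False
    then have "nc_even_partitions k = {}" by (rule nc_even_partitions_odd)
    then have "admissible_words [] ?w = {}" using bij_betw_partition_code[of k] by (simp add: bij_betw_def)
    then show ?thesis using False by (simp add: d_coeff_def f_coeff_odd)
  qed
  then show ?thesis using det_gram_matrix_rise_weight[OF assms] by simp
qed

end
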